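(* Let $\ell\in\mathbb N$ and let $k>\ell$ be an integer. Then there exists $\phi\in\mathrm{Hom}^+(\mathcal A[T_{k\text{-Hypergraph}}],\mathbb R)$ satisfying $\mathrm{Independence}[\ell]$ but not satisfying $\mathrm{UInduce}[\ell+1]$. (In particular $\mathrm{Independence}[\ell]$ does not imply $\mathrm{UInduce}[\ell+1]$.)
   Context: All languages are finite relational; predicates $P$ have arity $k(P)\ge1$. A canonical theory over $\mathcal L$ is a universal theory containing, for each $P\in\mathcal L$, the axiom that $P(x_1,\dots,x_{k(P)})$ fails whenever two $x_i$ coincide. $T_{k\text{-Hypergraph}}$ is the canonical theory with a single $k$-ary predicate $E$ and the symmetry axioms $E(x_1,\dots,x_k)\to E(x_{\sigma(1)},\dots,x_{\sigma(k)})$ for $\sigma\in S_k$. $T_1\cup T_2$ is the disjoint union. $\mathcal M[T]$: isomorphism classes of finite models. $\mathrm{Hom}^+(\mathcal A[T],\mathbb R)$: functions $\phi:\mathcal M[T]\to[0,1]$, $\phi(M)=\lim_n p(M,N_n)$ for finite models $N_n$ of $T$ of strictly increasing size ($p(M,N)$ = probability that a random $|M|$-subset of $V(N)$ induces a copy of $M$). Theons: for an atomless complete probability space $\Omega=(X,\mathcal A,\mu)$, $\mathcal E_V(\Omega)=X^{r(V)}$ with $r(V)$ the finite nonempty subsets of $V$, $\mathcal E_{V,\ell}(\Omega)=X^{\{A\in r(V):|A|\le\ell\}}$, $\mathcal E_k=\mathcal E_{[k]}$, $\alpha^*(x)_A=x_{\alpha(A)}$. A $T$-on is a family of measurable $\mathcal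 N_P\subseteq\mathcal E_{k(P)}(\Omega)$ such that for random $\theta\in\mathcal E_{\mathbb N_+}(\Omega)$ the structure $\mathbf K$ on $\mathbb N_+$ with $R_P(\mathbf K)=\{\alpha\text{ injective}:\alpha^*(\theta)\in\mathcal N_P\}$ is a.s. a model of $T$; $\phi_{\mathcal N}(M)=\Pr[\mathbf K|_{[|M|]}\cong M]$; every $\phi$ is of this form. $\ell$-independent peon: $\mathcal N_P=\mathcal E_{k,\ell}(\Omega)\times\mathcal H$ for some $\mathcal H\subseteq X^{\{A\subseteq[k]:|A|>\ell\}}$. $\mathrm{Independence}[\ell]$: $\phi=\phi_{\mathcal N}$ for a $T$-on with all peons $\ell$-independent. Couplings: for $\phi\in\mathrm{Hom}^+(\mathcal A[T],\mathbb R)$, $\psi\in\mathrm{Hom}^+(\mathcal A[T'],\mathbb R)$, a coupling is $\xi\in\mathrm{Hom}^+(\mathcal A[T\cup T'],\mathbb R)$ whose projections (sum of $\xi(N)$ over $N$ whose reduct to the respective language is isomorphic to a given model) are $\phi$ and $\psi$. The independent coupling is $(\phi\otimes\psi)(\langle M\rangle)=\phi(\langle M|_{T}\rangle)\psi(\langle M|_{T'}\rangle)$, where $\phi(\langle K\rangle)=\frac{|\mathrm{Aut}(K)|}{|K|!}\phi([K])$ and $M|_T$ is the reduct. For $m\ge1$, $\phi\in\mathrm{Hom}^+(\mathcal A[T],\mathbb R)$ satisfies $\mathrm{UInduce}[m]$ if for every $\psi\in\mathrm{Hom}^+(\mathcal A[T_{m\text{-Hypergraph}}],\mathbb R)$,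 every coupling $\xi$ of $\phi$ and $\psi$, and every $M\in\mathcal M[T\cup T_{m\text{-Hypergraph}}]$ whose hypergraph reduct is a complete $m$-uniform hypergraph, $\xi(M)=(\phi\otimes\psi)(M)$. *)

theory Defs
  imports "HOL-Probability.Probability" "HOL-Combinatorics.Permutations"
begin

(* Index sets are 0-based: [k] is {..<k}, and the positive integers as a vertex set become
   UNIV :: nat set. *)

section \<open>Universal theories in finite relational languages\<close>

(* Quantifier-free formulas in the variables x_0, x_1, ...; every axiom is read as its
   universal closure. *)
datatype 'p qf =
    Atom 'p "nat list"
  | Equal nat nat
  | Neg "'p qf"
  | Imp "'p qf" "'p qf"

(* The (finite) language is the whole type 'p. *)
record 'p univ_theory =
  arity :: "'p \<Rightarrow> nat"
  axioms :: "'p qf set"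

record ('p, 'v) struct =
  verts :: "'v set"
  rel :: "'p \<Rightarrow> 'v list set"

primrec holds :: "('p, 'v) struct \<Rightarrow> (nat \<Rightarrow> 'v) \<Rightarrow> 'p qf \<Rightarrow> bool" where
  "holds M v (Atom P xs) \<longleftrightarrow> map v xs \<in> rel M P"
| "holds M v (Equal i j) \<longleftrightarrow> v i = v j"
| "holds M v (Neg \<alpha>) \<longleftrightarrow> \<not> holds M v \<alpha>"
| "holds M v (Imp \<alpha> \<beta>) \<longleftrightarrow> (holds M v \<alpha> \<longrightarrow> holds M v \<beta>)"

definition model :: "'p univ_theory \<Rightarrow> ('p, 'v) struct \<Rightarrow> bool" where
  "model T M \<longleftrightarrow>
     (\<forall>P. rel M P \<subseteq> {xs. length xs = arity T P \<and> set xs \<subseteq> verts M}) \<and>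
     (\<forall>\<alpha>\<in>axioms T. \<forall>v. range v \<subseteq> verts M \<longrightarrow> holds M v \<alpha>)"

definition finite_model :: "'p univ_theory \<Rightarrow> ('p, 'v) struct \<Rightarrow> bool" where
  "finite_model T M \<longleftrightarrow> model T M \<and> finite (verts M)"

definition canonical_axioms :: "('p \<Rightarrow> nat) \<Rightarrow> 'p qf set" where
  "canonical_axioms ar =
     {Imp (Equal i j) (Neg (Atom P [0..<ar P])) | P i j. i < j \<and> j < ar P}"

definition hypergraph_theory :: "nat \<Rightarrow> unit univ_theory" where
  "hypergraph_theory k =
     \<lparr>arity = (\<lambda>_. k),
      axioms = canonical_axioms (\<lambda>_. k) \<union>
        {Imp (Atom () [0..<k]) (Atom () (map \<sigma> [0..<k])) | \<sigma>. \<sigma> permutes {..<k}}\<rparr>"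

definition disj_union :: "'p univ_theory \<Rightarrow> 'q univ_theory \<Rightarrow> ('p + 'q) univ_theory"
    (infixl "\<uplus>\<^sub>T" 65) where
  "T \<uplus>\<^sub>T T' =
     \<lparr>arity = case_sum (arity T) (arity T'),
      axioms = map_qf Inl ` axioms T \<union> map_qf Inr ` axioms T'\<rparr>"

definition reductl :: "('p + 'q, 'v) struct \<Rightarrow> ('p, 'v) struct" where
  "reductl M = \<lparr>verts = verts M, rel = (\<lambda>P. rel M (Inl P))\<rparr>"

definition reductr :: "('p + 'q, 'v) struct \<Rightarrow> ('q, 'v) struct" where
  "reductr M = \<lparr>verts = verts M, rel = (\<lambda>P. rel M (Inr P))\<rparr>"

definition induced :: "('p, 'v) struct \<Rightarrow> 'v set \<Rightarrow> ('p, 'v) struct" where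
  "induced M U =
     \<lparr>verts = verts M \<inter> U, rel = (\<lambda>P. {xs \<in> rel M P. set xs \<subseteq> U})\<rparr>"

definition iso_map :: "('v \<Rightarrow> 'w) \<Rightarrow> ('p, 'v) struct \<Rightarrow> ('p, 'w) struct \<Rightarrow> bool" where
  "iso_map f M N \<longleftrightarrow>
     bij_betw f (verts M) (verts N) \<and> (\<forall>P. rel N P = map f ` rel M P)"

definition isomorphic :: "('p, 'v) struct \<Rightarrow> ('p, 'w) struct \<Rightarrow> bool" (infix "\<cong>\<^sub>S" 50) where
  "M \<cong>\<^sub>S N \<longleftrightarrow> (\<exists>f. iso_map f M N)"

(* f is the identity off verts M, so automorphisms are counted correctly. *)
definition Aut :: "('p, 'v) struct \<Rightarrow> ('v \<Rightarrow> 'v) set" where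
  "Aut M = {f. f permutes verts M \<and> iso_map f M M}"

(* Every finite structure has a copy whose vertices are natural numbers. *)
definition iso_class :: "('p, nat) struct \<Rightarrow> ('p, nat) struct set" where
  "iso_class M = {N. M \<cong>\<^sub>S N}"

definition iso_types :: "'p univ_theory \<Rightarrow> ('p, nat) struct set set" where
  "iso_types T = iso_class ` {M. finite_model T M}"


section \<open>Limits and couplings\<close>

definition dens :: "('p, 'v) struct \<Rightarrow> ('p, 'w) struct \<Rightarrow> real" where
  "dens M N =
     real (card {U. U \<subseteq> verts N \<and> card U = card (verts M) \<and> induced N U \<cong>\<^sub>S M})
       / real (card (verts N) choose card (verts M))"

definition Hom_plus ::
    "'p::finite univ_theory \<Rightarrow> (('p, nat) struct set \<Rightarrow> real) set" where
  "Hom_plus T =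
     {\<phi> \<in> iso_types T \<rightarrow>\<^sub>E {0..1}.
        \<exists>N :: nat \<Rightarrow> ('p, nat) struct.
          (\<forall>n. finite_model T (N n)) \<and>
          strict_mono (\<lambda>n. card (verts (N n))) \<and>
          (\<forall>M. finite_model T M \<longrightarrow> (\<lambda>n. dens M (N n)) \<longlonglongrightarrow> \<phi> (iso_class M))}"

(* The value at the labelled structure, written \<phi>(<K>) in the literature. *)
definition labelled ::
    "(('p, nat) struct set \<Rightarrow> real) \<Rightarrow> ('p, nat) struct \<Rightarrow> real" where
  "labelled \<phi> K = real (card (Aut K)) / fact (card (verts K)) * \<phi> (iso_class K)"

definition coupling ::
    "'p::finite univ_theory \<Rightarrow> 'q::finite univ_theory \<Rightarrow>
     (('p, nat) struct set \<Rightarrow> real) \<Rightarrow> (('q, nat) struct set \<Rightarrow> real) \<Rightarrow>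
     (('p + 'q, nat) struct set \<Rightarrow> real) \<Rightarrow> bool" where
  "coupling T T' \<phi> \<psi> \<xi> \<longleftrightarrow>
     \<xi> \<in> Hom_plus (T \<uplus>\<^sub>T T') \<and>
     (\<forall>C \<in> iso_types T.
        \<phi> C = (\<Sum>D | D \<in> iso_types (T \<uplus>\<^sub>T T') \<and> (\<exists>N\<in>D. reductl N \<in> C). \<xi> D)) \<and>
     (\<forall>C \<in> iso_types T'.
        \<psi> C = (\<Sum>D | D \<in> iso_types (T \<uplus>\<^sub>T T') \<and> (\<exists>N\<in>D. reductr N \<in> C). \<xi> D))"

(* The defining equation of the independent coupling at labelled structures,
     labelled (\<phi> \<otimes> \<psi>) M = labelled \<phi> (reductl M) * labelled \<psi> (reductr M),
   solved for the value at the class of M; see labelled_indep_coupling below. *)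
definition indep_coupling ::
    "'p univ_theory \<Rightarrow> 'q univ_theory \<Rightarrow>
     (('p, nat) struct set \<Rightarrow> real) \<Rightarrow> (('q, nat) struct set \<Rightarrow> real) \<Rightarrow>
     (('p + 'q, nat) struct set \<Rightarrow> real)" where
  "indep_coupling T T' \<phi> \<psi> =
     (\<lambda>D \<in> iso_types (T \<uplus>\<^sub>T T').
        let M = (SOME M. M \<in> D) in
          fact (card (verts M)) / real (card (Aut M)) *
          (labelled \<phi> (reductl M) * labelled \<psi> (reductr M)))"

definition complete_hypergraph :: "nat \<Rightarrow> (unit, 'v) struct \<Rightarrow> bool" where
  "complete_hypergraph m H \<longleftrightarrow>
     rel H () = {xs. length xs = m \<and> distinct xs \<and> set xs \<subseteq> verts H}"

definition UInduce ::
    "nat \<Rightarrow> 'p::finite univ_theory \<Rightarrow> (('p, nat) struct set \<Rightarrow> real) \<Rightarrow> bool" where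
  "UInduce m T \<phi> \<longleftrightarrow>
     (\<forall>\<psi> \<in> Hom_plus (hypergraph_theory m). \<forall>\<xi>.
        coupling T (hypergraph_theory m) \<phi> \<psi> \<xi> \<longrightarrow>
        (\<forall>M. finite_model (T \<uplus>\<^sub>T hypergraph_theory m) M \<and>
             complete_hypergraph m (reductr M) \<longrightarrow>
             \<xi> (iso_class M) =
               indep_coupling T (hypergraph_theory m) \<phi> \<psi> (iso_class M)))"


section \<open>Theons\<close>

definition atomless :: "'x measure \<Rightarrow> bool" where
  "atomless \<Omega> \<longleftrightarrow>
     (\<forall>A \<in> sets \<Omega>. 0 < emeasure \<Omega> A \<longrightarrow>
        (\<exists>B \<in> sets \<Omega>. B \<subseteq> A \<and> 0 < emeasure \<Omega> B \<and> emeasure \<Omega> B < emeasure \<Omega> A))"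

definition fin_subsets :: "nat set \<Rightarrow> nat set set" where
  "fin_subsets V = {A. A \<subseteq> V \<and> finite A \<and> A \<noteq> {}}"

(* The product space X^r(V), completed as usual: the product of complete measures need not be
   complete. *)
definition \<E> :: "nat set \<Rightarrow> 'x measure \<Rightarrow> (nat set \<Rightarrow> 'x) measure" where
  "\<E> V \<Omega> = completion (Pi\<^sub>M (fin_subsets V) (\<lambda>_. \<Omega>))"

(* The injection [k] \<rightarrow> V is given by the list \<alpha> of its values. *)
definition pullback :: "nat list \<Rightarrow> (nat set \<Rightarrow> 'x) \<Rightarrow> (nat set \<Rightarrow> 'x)" where
  "pullback \<alpha> x = (\<lambda>A \<in> fin_subsets {..<length \<alpha>}. x ((!) \<alpha> ` A))"

definition theon_struct ::
    "'p univ_theory \<Rightarrow> ('p \<Rightarrow> (nat set \<Rightarrow> 'x) set) \<Rightarrow> (nat set \<Rightarrow> 'x) \<Rightarrow> ('p, nat) struct" where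
  "theon_struct T \<N> \<theta> =
     \<lparr>verts = UNIV,
      rel = (\<lambda>P. {\<alpha>. length \<alpha> = arity T P \<and> distinct \<alpha> \<and> pullback \<alpha> \<theta> \<in> \<N> P})\<rparr>"

definition theon ::
    "'p::finite univ_theory \<Rightarrow> 'x measure \<Rightarrow> ('p \<Rightarrow> (nat set \<Rightarrow> 'x) set) \<Rightarrow> bool" where
  "theon T \<Omega> \<N> \<longleftrightarrow>
     (\<forall>P. \<N> P \<in> sets (\<E> {..<arity T P} \<Omega>)) \<and>
     (AE \<theta> in \<E> UNIV \<Omega>. model T (theon_struct T \<N> \<theta>))"

definition theon_dens ::
    "'p univ_theory \<Rightarrow> 'x measure \<Rightarrow> ('p \<Rightarrow> (nat set \<Rightarrow> 'x) set) \<Rightarrow> ('p, nat) struct \<Rightarrow> real" where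
  "theon_dens T \<Omega> \<N> M =
     measure (\<E> UNIV \<Omega>)
       {\<theta> \<in> space (\<E> UNIV \<Omega>). induced (theon_struct T \<N> \<theta>) {..<card (verts M)} \<cong>\<^sub>S M}"

(* merge identifies X^I \<times> X^J with X^(I \<union> J) for disjoint I and J. *)
definition indep_peon :: "nat \<Rightarrow> nat \<Rightarrow> 'x measure \<Rightarrow> (nat set \<Rightarrow> 'x) set \<Rightarrow> bool" where
  "indep_peon l k \<Omega> S \<longleftrightarrow>
     (let I = {A \<in> fin_subsets {..<k}. card A \<le> l};
          J = {A \<in> fin_subsets {..<k}. card A > l}
      in \<exists>H \<subseteq> J \<rightarrow>\<^sub>E space \<Omega>. S = merge I J ` ((I \<rightarrow>\<^sub>E space \<Omega>) \<times> H))"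

(* HOL cannot quantify over the type of points of \<Omega>; all atomless complete probability spaces on
   sets of reals are allowed, which includes the standard one, [0,1] with Lebesgue measure. *)
definition Independence ::
    "nat \<Rightarrow> 'p::finite univ_theory \<Rightarrow> (('p, nat) struct set \<Rightarrow> real) \<Rightarrow> bool" where
  "Independence l T \<phi> \<longleftrightarrow>
     (\<exists>(\<Omega> :: real measure) \<N>.
        prob_space \<Omega> \<and> complete_measure \<Omega> \<and> atomless \<Omega> \<and>
        theon T \<Omega> \<N> \<and>
        (\<forall>P. indep_peon l (arity T P) \<Omega> (\<N> P)) \<and>
        (\<forall>M. finite_model T M \<longrightarrow> \<phi> (iso_class M) = theon_dens T \<Omega> \<N> M))"


section \<open>Basic facts\<close>

definition wf_struct :: "('p, 'v) struct \<Rightarrow> bool" where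
  "wf_struct M \<longleftrightarrow> (\<forall>P. rel M P \<subseteq> lists (verts M))"

lemma model_wf_struct: "model T M \<Longrightarrow> wf_struct M"
  by (auto simp: model_def wf_struct_def)

lemma wf_reductl: "wf_struct M \<Longrightarrow> wf_struct (reductl M)"
  and wf_reductr: "wf_struct M \<Longrightarrow> wf_struct (reductr M)"
  by (auto simp: wf_struct_def reductl_def reductr_def)

lemma iso_map_reductl: "iso_map f M N \<Longrightarrow> iso_map f (reductl M) (reductl N)"
  and iso_map_reductr: "iso_map f M N \<Longrightarrow> iso_map f (reductr M) (reductr N)"
  by (auto simp: iso_map_def reductl_def reductr_def)

lemma iso_map_bij: "iso_map f M N \<Longrightarrow> bij_betw f (verts M) (verts N)"
  and iso_map_rel: "iso_map f M N \<Longrightarrow> rel N P = map f ` rel M P"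
  unfolding iso_map_def by (erule conjE, assumption) (erule conjE, erule spec)

lemma iso_mapI:
  "bij_betw f (verts M) (verts N) \<Longrightarrow> (\<And>P. rel N P = map f ` rel M P) \<Longrightarrow> iso_map f M N"
  unfolding iso_map_def by (intro conjI allI)

lemma iso_map_comp:
  assumes "iso_map f M N" and "iso_map g N L"
  shows "iso_map (g \<circ> f) M L"
proof (rule iso_mapI)
  show "bij_betw (g \<circ> f) (verts M) (verts L)"
    by (rule bij_betw_trans[OF iso_map_bij[OF assms(1)] iso_map_bij[OF assms(2)]])
  show "rel L P = map (g \<circ> f) ` rel M P" for P
    by (simp only: iso_map_rel[OF assms(2)] iso_map_rel[OF assms(1)] image_image map_map)
qed

lemma iso_map_id: "iso_map id M M"
  unfolding iso_map_def by auto

lemma isomorphic_refl: "M \<cong>\<^sub>S M"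
  unfolding isomorphic_def using iso_map_id by blast

lemma isomorphic_trans: "M \<cong>\<^sub>S N \<Longrightarrow> N \<cong>\<^sub>S L \<Longrightarrow> M \<cong>\<^sub>S L"
  unfolding isomorphic_def using iso_map_comp by blast

lemma iso_map_wf:
  assumes f: "iso_map f M N" and wf: "wf_struct M"
  shows "wf_struct N"
proof -
  have "map f xs \<in> lists (verts N)" if "xs \<in> lists (verts M)" for xs
    using that bij_betwE[OF iso_map_bij[OF f]] by auto
  then show ?thesis using wf unfolding wf_struct_def iso_map_rel[OF f] by blast
qed

lemma iso_map_cong:
  assumes "wf_struct M" and "\<And>x. x \<in> verts M \<Longrightarrow> f x = g x"
  shows "iso_map f M N \<longleftrightarrow> iso_map g M N"
proof -
  have "map f xs = map g xs" if "xs \<in> rel M P" for xs P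
  proof -
    have "set xs \<subseteq> verts M" using that assms(1) unfolding wf_struct_def by blast
    then show ?thesis using assms(2) by (intro map_cong) auto
  qed
  then have "map f ` rel M P = map g ` rel M P" for P by (intro image_cong) auto
  moreover have "bij_betw f (verts M) (verts N) \<longleftrightarrow> bij_betw g (verts M) (verts N)"
    by (rule bij_betw_cong) (rule assms(2))
  ultimately show ?thesis unfolding iso_map_def by (simp only:)
qed

lemma iso_map_inv:
  assumes f: "iso_map f M N" and wf: "wf_struct M"
  shows "iso_map (inv_into (verts M) f) N M"
proof -
  let ?g = "inv_into (verts M) f"
  have b: "bij_betw f (verts M) (verts N)" by (rule iso_map_bij[OF f])
  have inv: "map ?g (map f xs) = xs" if "xs \<in> rel M P" for xs P
  proof -
    have "set xs \<subseteq> verts M" using that wf unfolding wf_struct_def by blast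
    then have "map (?g \<circ> f) xs = map id xs"
      using bij_betw_inv_into_left[OF b] by (intro map_cong) auto
    then show ?thesis by simp
  qed
  have rel: "rel M P = map ?g ` rel N P" for P
  proof -
    have "map ?g ` rel N P = (\<lambda>xs. map ?g (map f xs)) ` rel M P"
      by (simp only: iso_map_rel[OF f] image_image)
    also have "\<dots> = id ` rel M P" using inv by (intro image_cong) auto
    finally show ?thesis by (simp only: image_id id_apply)
  qed
  show ?thesis by (rule iso_mapI[OF bij_betw_inv_into[OF b] rel])
qed

lemma isomorphic_sym: "M \<cong>\<^sub>S N \<Longrightarrow> wf_struct M \<Longrightarrow> N \<cong>\<^sub>S M"
  unfolding isomorphic_def using iso_map_inv by blast

lemma iso_class_cong:
  assumes "M \<cong>\<^sub>S N" and "wf_struct M"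
  shows "iso_class M = iso_class N"
  using isomorphic_trans isomorphic_sym[OF assms] assms(1) unfolding iso_class_def by blast

lemma card_Aut_le:
  assumes f: "iso_map f M N" and wf: "wf_struct M" and fin: "finite (verts N)"
  shows "card (Aut M) \<le> card (Aut N)"
proof (rule card_inj_on_le)
  let ?g = "inv_into (verts M) f"
  let ?c = "\<lambda>h y. if y \<in> verts N then f (h (?g y)) else y"
  have b: "bij_betw f (verts M) (verts N)" by (rule iso_map_bij[OF f])
  show "finite (Aut N)"
    by (rule finite_subset[OF _ finite_permutations[OF fin]]) (auto simp: Aut_def)
  show "?c ` Aut M \<subseteq> Aut N"
  proof
    fix c assume "c \<in> ?c ` Aut M"
    then obtain h where h: "h \<in> Aut M" and c: "c = ?c h" by blast
    have "iso_map h M M" using h unfolding Aut_def by blast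
    have fhg: "iso_map (f \<circ> (h \<circ> ?g)) N N"
      by (rule iso_map_comp[OF iso_map_comp[OF iso_map_inv[OF f wf] \<open>iso_map h M M\<close>] f])
    have "iso_map c N N \<longleftrightarrow> iso_map (f \<circ> (h \<circ> ?g)) N N"
      by (rule iso_map_cong[OF iso_map_wf[OF f wf]]) (simp add: c)
    with fhg have cN: "iso_map c N N" by (simp only:)
    then have "bij_betw c (verts N) (verts N)" by (rule iso_map_bij)
    then have "c permutes verts N" by (rule bij_imp_permutes) (simp add: c)
    with cN show "c \<in> Aut N" unfolding Aut_def by blast
  qed
  show "inj_on ?c (Aut M)"
  proof (rule inj_onI, rule ext)
    fix h h' x assume h: "h \<in> Aut M" and h': "h' \<in> Aut M" and eq: "?c h = ?c h'"
    have p: "h permutes verts M" "h' permutes verts M" using h h' by (auto simp: Aut_def)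
    show "h x = h' x"
    proof (cases "x \<in> verts M")
      case True
      then have fx: "f x \<in> verts N" "?g (f x) = x"
        using b by (auto simp: bij_betw_def)
      have "f (h x) = f (h' x)" using fun_cong[OF eq, of "f x"] fx by simp
      moreover have "h x \<in> verts M" "h' x \<in> verts M"
        using p True by (auto simp: permutes_in_image)
      ultimately show ?thesis using b by (meson bij_betw_def inj_onD)
    next
      case False
      then show ?thesis using p by (metis permutes_not_in)
    qed
  qed
qed

lemma card_Aut_cong:
  assumes "iso_map f M N" and "wf_struct M" and "finite (verts M)"
  shows "card (Aut M) = card (Aut N)"
proof (rule antisym)
  have "finite (verts N)"
    using assms(3) bij_betw_finite[OF iso_map_bij[OF assms(1)]] by blast
  then show "card (Aut M) \<le> card (Aut N)" by (rule card_Aut_le[OF assms(1,2)])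
  show "card (Aut N) \<le> card (Aut M)"
    by (rule card_Aut_le[OF iso_map_inv[OF assms(1,2)] iso_map_wf[OF assms(1,2)] assms(3)])
qed

lemma labelled_cong:
  assumes "iso_map f M N" and "wf_struct M" and "finite (verts M)"
  shows "labelled \<phi> M = labelled \<phi> N"
proof -
  have "card (verts M) = card (verts N)"
    by (rule bij_betw_same_card[OF iso_map_bij[OF assms(1)]])
  moreover have "iso_class M = iso_class N"
    using iso_class_cong assms(1,2) unfolding isomorphic_def by blast
  ultimately show ?thesis
    using card_Aut_cong[OF assms] by (simp add: labelled_def)
qed

lemma labelled_indep_coupling:
  assumes "finite_model (T \<uplus>\<^sub>T T') M"
  shows "labelled (indep_coupling T T' \<phi> \<psi>) M = labelled \<phi> (reductl M) * labelled \<psi> (reductr M)"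
proof -
  have wf: "wf_struct M" and fin: "finite (verts M)"
    using assms model_wf_struct by (auto simp: finite_model_def)
  define N where "N = (SOME N. N \<in> iso_class M)"
  have "N \<in> iso_class M"
    unfolding N_def by (rule someI[of _ M]) (simp add: iso_class_def isomorphic_refl)
  then obtain f where f: "iso_map f M N" by (auto simp: iso_class_def isomorphic_def)
  have "card (verts M) = card (verts N)"
    by (rule bij_betw_same_card[OF iso_map_bij[OF f]])
  moreover have "card (Aut M) = card (Aut N)" by (rule card_Aut_cong[OF f wf fin])
  moreover have "labelled \<phi> (reductl M) = labelled \<phi> (reductl N)"
    by (rule labelled_cong[OF iso_map_reductl[OF f] wf_reductl[OF wf]])
      (simp add: fin reductl_def)
  moreover have "labelled \<psi> (reductr M) = labelled \<psi> (reductr N)"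
    by (rule labelled_cong[OF iso_map_reductr[OF f] wf_reductr[OF wf]])
      (simp add: fin reductr_def)
  moreover have "card (Aut M) \<noteq> 0"
  proof -
    have "id \<in> Aut M" using iso_map_id permutes_id unfolding Aut_def by blast
    moreover have "finite (Aut M)"
      by (rule finite_subset[OF _ finite_permutations[OF fin]]) (auto simp: Aut_def)
    ultimately show ?thesis by auto
  qed
  moreover have "iso_class M \<in> iso_types (T \<uplus>\<^sub>T T')"
    using assms by (auto simp: iso_types_def)
  ultimately show ?thesis
    unfolding labelled_def[of "indep_coupling T T' \<phi> \<psi>" M]
    by (simp add: indep_coupling_def N_def[symmetric] Let_def)
qed

lemma model_hypergraph_theory_iff:
  "model (hypergraph_theory k) M \<longleftrightarrow>
     rel M () \<subseteq> {xs. length xs = k \<and> distinct xs \<and> set xs \<subseteq> verts M} \<and>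
     (\<forall>xs \<in> rel M (). \<forall>\<sigma>. \<sigma> permutes {..<k} \<longrightarrow> map (\<lambda>i. xs ! \<sigma> i) [0..<k] \<in> rel M ())"
  (is "?L \<longleftrightarrow> ?D \<and> ?S")
proof
  assume L: ?L
  have wf: "length xs = k" "set xs \<subseteq> verts M" if "xs \<in> rel M ()" for xs
    using L that by (auto simp: model_def hypergraph_theory_def)
  have ax: "holds M v \<alpha>" if "\<alpha> \<in> axioms (hypergraph_theory k)" "range v \<subseteq> verts M" for v \<alpha>
    using L that by (auto simp: model_def)
  have v: "\<exists>v. range v \<subseteq> verts M \<and> map v [0..<k] = xs \<and> (\<forall>i<k. v i = xs ! i)"
    if xs: "xs \<in> rel M ()" and k: "k > 0" for xs
  proof (intro exI conjI)
    let ?v = "\<lambda>i. if i < k then xs ! i else xs ! 0"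
    show "range ?v \<subseteq> verts M" using wf[OF xs] k by (auto simp: subset_iff)
    show "map ?v [0..<k] = xs" using wf[OF xs] by (intro nth_equalityI) auto
    show "\<forall>i<k. ?v i = xs ! i" by simp
  qed
  have "distinct xs" if xs: "xs \<in> rel M ()" for xs
  proof (rule ccontr)
    assume "\<not> distinct xs"
    then obtain i j where ij: "i < j" "j < k" "xs ! i = xs ! j"
      using wf[OF xs] unfolding distinct_conv_nth by (metis linorder_neq_iff)
    obtain v where v: "range v \<subseteq> verts M" "map v [0..<k] = xs" "\<forall>i<k. v i = xs ! i"
      using v[OF xs] ij by auto
    have "Imp (Equal i j) (Neg (Atom () [0..<k])) \<in> axioms (hypergraph_theory k)"
      using ij by (auto simp: hypergraph_theory_def canonical_axioms_def)
    from ax[OF this v(1)] show False using v ij xs by auto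
  qed
  moreover have ?S
  proof (intro ballI allI impI)
    fix xs \<sigma> assume xs: "xs \<in> rel M ()" and \<sigma>: "\<sigma> permutes {..<k}"
    show "map (\<lambda>i. xs ! \<sigma> i) [0..<k] \<in> rel M ()"
    proof (cases "k = 0")
      case True then show ?thesis using xs wf[OF xs] by simp
    next
      case False
      obtain v where v: "range v \<subseteq> verts M" "map v [0..<k] = xs" "\<forall>i<k. v i = xs ! i"
        using v[OF xs] False by auto
      have "Imp (Atom () [0..<k]) (Atom () (map \<sigma> [0..<k])) \<in> axioms (hypergraph_theory k)"
        using \<sigma> by (auto simp: hypergraph_theory_def)
      from ax[OF this v(1)] have "map v (map \<sigma> [0..<k]) \<in> rel M ()" using v xs by auto
      moreover have "map v (map \<sigma> [0..<k]) = map (\<lambda>i. xs ! \<sigma> i) [0..<k]"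
        using v(3) permutes_in_image[OF \<sigma>] by auto
      ultimately show ?thesis by (simp only:)
    qed
  qed
  ultimately show "?D \<and> ?S" using wf by blast
next
  assume R: "?D \<and> ?S"
  have "holds M v \<alpha>" if \<alpha>: "\<alpha> \<in> axioms (hypergraph_theory k)" for v \<alpha>
  proof -
    from \<alpha> consider
      (can) i j where "i < j" "j < k" "\<alpha> = Imp (Equal i j) (Neg (Atom () [0..<k]))"
    | (sym) \<sigma> where "\<sigma> permutes {..<k}" "\<alpha> = Imp (Atom () [0..<k]) (Atom () (map \<sigma> [0..<k]))"
      by (auto simp: hypergraph_theory_def canonical_axioms_def)
    then show ?thesis
    proof cases
      case can
      have "\<not> distinct (map v [0..<k])" if "v i = v j"
      proof
        assume "distinct (map v [0..<k])"
        then have "map v [0..<k] ! i \<noteq> map v [0..<k] ! j"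
          using can by (subst nth_eq_iff_index_eq) auto
        then show False using can that by simp
      qed
      moreover have "rel M () \<subseteq> {xs. distinct xs}" using R by blast
      ultimately show ?thesis unfolding can(3) holds.simps by blast
    next
      case sym
      have eq: "map v (map \<sigma> [0..<k]) = map (\<lambda>i. map v [0..<k] ! \<sigma> i) [0..<k]"
        using permutes_in_image[OF sym(1)] by auto
      have "\<forall>xs \<in> rel M (). map (\<lambda>i. xs ! \<sigma> i) [0..<k] \<in> rel M ()" using R sym(1) by blast
      then show ?thesis unfolding sym(2) holds.simps eq by blast
    qed
  qed
  moreover have "rel M P \<subseteq> {xs. length xs = k \<and> set xs \<subseteq> verts M}" for P
    using conjunct1[OF R] by (cases P) blast
  moreover have "arity (hypergraph_theory k) P = k" for P by (simp add: hypergraph_theory_def)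
  ultimately show ?L unfolding model_def by presburger
qed

end

theory Submission
  imports Defs "HOL-Library.Ramsey"
begin

text \<open>
  Put \<open>m = l + 1\<close>, let \<open>G\<close> be the random \<open>m\<close>-uniform hypergraph with edge probability \<open>1/2\<close>,
  and let the edges of the \<open>k\<close>-hypergraph be the \<open>k\<close>-sets that are cliques of \<open>G\<close>. Whether a
  \<open>k\<close>-set is an edge depends only on coordinates indexed by \<open>m\<close>-sets, so its limit \<open>\<phi>\<close> is
  \<open>l\<close>-independent. Coupled with \<open>G\<close> itself, the complete structure on \<open>k\<close> vertices has
  probability \<open>q = 2 ^ -(k choose m)\<close>, as against \<open>q * q\<close> in the independent coupling.
\<close>

section \<open>Clique structures of uniform hypergraphs\<close>

text \<open>\<open>clique_struct\<close> works over any language so that one computation serves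
  three limits: every predicate holds on the repetition-free tuples whose entries form a clique of
  \<open>G\<close>. Arity \<open>m\<close> gives the edges of \<open>G\<close>, arity
  \<open>k\<close> its \<open>k\<close>-cliques, and the disjoint union of the two languages both at
  once. So \<phi>, \<psi> and the coupling \<xi> are instances of the same construction, and reducts
  keep \<open>G\<close>.

  The obstacle is \<open>Hom_plus\<close>, which asks for one deterministic sequence of finite
  models along which all densities converge. The random hypergraph is derandomised by a second
  moment bound and averaging, with probabilities written as counts over
  \<open>Pow (nsets V m)\<close>. Product measures enter only with the theon, which has to return
  the same counts.

  The values \<open>q\<close> and \<open>q * q\<close> differ from the expected pattern because, on
  \<open>k\<close> vertices, the complete \<open>k\<close>-ary, \<open>m\<close>-ary and joint
  structures all describe the single event that \<open>G\<close> is complete.\<close>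

definition clique_struct ::
    "('p \<Rightarrow> nat) \<Rightarrow> nat \<Rightarrow> 'v set \<Rightarrow> 'v set set \<Rightarrow> ('p, 'v) struct" where
  "clique_struct ar m V G =
     \<lparr>verts = V,
      rel = (\<lambda>P. {xs. length xs = ar P \<and> distinct xs \<and> set xs \<subseteq> V \<and> nsets (set xs) m \<subseteq> G})\<rparr>"

lemma verts_clique_struct [simp]: "verts (clique_struct ar m V G) = V"
  by (simp add: clique_struct_def)

lemma rel_clique_struct:
  "rel (clique_struct ar m V G) P =
     {xs. length xs = ar P \<and> distinct xs \<and> set xs \<subseteq> V \<and> nsets (set xs) m \<subseteq> G}"
  by (simp add: clique_struct_def)

lemma wf_clique_struct: "wf_struct (clique_struct ar m V G)"
  by (auto simp: wf_struct_def clique_struct_def)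

lemma reductl_clique_struct:
    "reductl (clique_struct ar m V G) = clique_struct (ar \<circ> Inl) m V G"
  and reductr_clique_struct:
    "reductr (clique_struct ar m V G) = clique_struct (ar \<circ> Inr) m V G"
  by (simp_all add: reductl_def reductr_def clique_struct_def)

lemma induced_clique_struct:
  "U \<subseteq> V \<Longrightarrow> induced (clique_struct ar m V G) U = clique_struct ar m U G"
  by (auto simp: induced_def clique_struct_def)

text \<open>Only edges of \<open>G\<close> inside \<open>V\<close> are ever inspected. This locality
  later makes disjoint vertex sets independent and reduces events to finitely many
  coordinates.\<close>

lemma clique_struct_cong:
  assumes "G \<inter> nsets V m = G' \<inter> nsets V m"
  shows "clique_struct ar m V G = clique_struct ar m V G'"
proof -
  have "nsets (set xs) m \<subseteq> G \<longleftrightarrow> nsets (set xs) m \<subseteq> G'" if "set xs \<subseteq> V" for xs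
    using nsets_mono[OF that, of m] assms by blast
  then show ?thesis by (auto simp: clique_struct_def fun_eq_iff)
qed

text \<open>A bijection matches the \<open>m\<close>-subsets of \<open>V\<close> with those of
  \<open>W\<close>, so agreement of \<open>G\<close> and \<open>G'\<close> on these sets is enough
  to transport all cliques.\<close>

lemma iso_map_clique_struct:
  assumes bij: "bij_betw f V W"
    and G: "\<And>B. B \<in> nsets V m \<Longrightarrow> f ` B \<in> G' \<longleftrightarrow> B \<in> G"
  shows "iso_map f (clique_struct ar m V G) (clique_struct ar m W G')"
proof (rule iso_mapI)
  show "bij_betw f (verts (clique_struct ar m V G)) (verts (clique_struct ar m W G'))"
    using bij by simp
  have inj: "inj_on f V" and W: "W = f ` V" using bij by (auto simp: bij_betw_def)
  have sub: "nsets (f ` A) m \<subseteq> G' \<longleftrightarrow> nsets A m \<subseteq> G" if "A \<subseteq> V" for A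
  proof -
    have "nsets (f ` A) m = image f ` nsets A m"
      using bij_betw_nsets[OF inj_on_imp_bij_betw[OF inj_on_subset[OF inj that]], of m]
      by (simp add: bij_betw_def)
    moreover have "B \<in> nsets V m" if "B \<in> nsets A m" for B
      using nsets_mono[OF \<open>A \<subseteq> V\<close>] that by blast
    ultimately show ?thesis using G by auto
  qed
  show "rel (clique_struct ar m W G') P = map f ` rel (clique_struct ar m V G) P" for P
  proof (intro equalityI subsetI)
    fix ys assume ys: "ys \<in> rel (clique_struct ar m W G') P"
    let ?xs = "map (inv_into V f) ys"
    have W': "set ys \<subseteq> f ` V" using ys W by (auto simp: clique_struct_def)
    then have f: "map f ?xs = ys" by (auto simp: f_inv_into_f intro!: map_idI)
    have V: "set ?xs \<subseteq> V" using W' by (auto intro!: inv_into_into)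
    have "distinct (map f ?xs)" "nsets (f ` set ?xs) m \<subseteq> G'" "length ?xs = ar P"
      unfolding set_map[symmetric] f using ys by (simp_all add: rel_clique_struct)
    then have "?xs \<in> rel (clique_struct ar m V G) P"
      using V sub[OF V] unfolding rel_clique_struct distinct_map mem_Collect_eq by blast
    then show "ys \<in> map f ` rel (clique_struct ar m V G) P" by (intro image_eqI[where x = ?xs]) (simp_all only: f)
  next
    fix ys assume "ys \<in> map f ` rel (clique_struct ar m V G) P"
    then obtain xs where ys: "ys = map f xs" and xs: "length xs = ar P" "distinct xs"
        "set xs \<subseteq> V" "nsets (set xs) m \<subseteq> G"
      by (auto simp: rel_clique_struct)
    have "distinct ys" using xs inj_on_subset[OF inj] by (simp add: ys distinct_map)
    moreover have "set ys \<subseteq> W" using xs W by (auto simp: ys)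
    moreover have "nsets (set ys) m \<subseteq> G'" using xs sub by (simp add: ys)
    ultimately show "ys \<in> rel (clique_struct ar m W G') P"
      using xs by (simp add: rel_clique_struct ys)
  qed
qed

text \<open>Membership of a tuple depends only on its length, its distinctness and its underlying
  set, which permuting the positions preserves.\<close>

lemma model_clique_hypergraph: "model (hypergraph_theory k) (clique_struct (\<lambda>_. k) m V G)"
  unfolding model_hypergraph_theory_iff
proof (intro conjI ballI allI impI)
  show "rel (clique_struct (\<lambda>_. k) m V G) ()
      \<subseteq> {xs. length xs = k \<and> distinct xs \<and> set xs \<subseteq> verts (clique_struct (\<lambda>_. k) m V G)}"
    by (auto simp: clique_struct_def)
  fix xs \<sigma> assume xs: "xs \<in> rel (clique_struct (\<lambda>_. k) m V G) ()" and \<sigma>: "\<sigma> permutes {..<k}"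
  have len: "length xs = k" using xs by (simp add: clique_struct_def)
  have "mset (map (\<lambda>i. xs ! \<sigma> i) [0..<k]) = mset xs"
    using mset_permute_list[of \<sigma> xs] \<sigma> len by (simp add: permute_list_def)
  then have "set (map (\<lambda>i. xs ! \<sigma> i) [0..<k]) = set xs"
    and "distinct (map (\<lambda>i. xs ! \<sigma> i) [0..<k]) \<longleftrightarrow> distinct xs"
    by (rule mset_eq_setD, rule mset_eq_imp_distinct_iff)
  then show "map (\<lambda>i. xs ! \<sigma> i) [0..<k] \<in> rel (clique_struct (\<lambda>_. k) m V G) ()"
    using xs unfolding rel_clique_struct by simp
qed

section \<open>Models of a disjoint union and invariance under isomorphism\<close>

lemma holds_map_qf_Inl: "holds M v (map_qf Inl \<alpha>) \<longleftrightarrow> holds (reductl M) v \<alpha>"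
  by (induction \<alpha>) (simp_all add: reductl_def)

lemma holds_map_qf_Inr: "holds M v (map_qf Inr \<alpha>) \<longleftrightarrow> holds (reductr M) v \<alpha>"
  by (induction \<alpha>) (simp_all add: reductr_def)

lemma model_disj_union:
  assumes "model T (reductl M)" and "model T' (reductr M)"
  shows "model (T \<uplus>\<^sub>T T') M"
proof -
  have "rel M P \<subseteq> {xs. length xs = arity (T \<uplus>\<^sub>T T') P \<and> set xs \<subseteq> verts M}" for P
    using assms by (cases P) (auto simp: model_def reductl_def reductr_def disj_union_def)
  moreover have "verts (reductl M) = verts M" "verts (reductr M) = verts M"
    by (simp_all add: reductl_def reductr_def)
  ultimately show ?thesis
    using assms by (auto simp: model_def disj_union_def holds_map_qf_Inl holds_map_qf_Inr)
qed

lemma isomorphic_cong_right: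
  assumes "M \<cong>\<^sub>S N" and "wf_struct M"
  shows "K \<cong>\<^sub>S M \<longleftrightarrow> K \<cong>\<^sub>S N"
  using isomorphic_trans[OF _ assms(1)] isomorphic_trans[OF _ isomorphic_sym[OF assms]]
  by (rule iffI)

lemma isomorphic_cong_left:
  assumes "M \<cong>\<^sub>S N" and "wf_struct M"
  shows "M \<cong>\<^sub>S K \<longleftrightarrow> N \<cong>\<^sub>S K"
  using isomorphic_trans[OF isomorphic_sym[OF assms]] isomorphic_trans[OF assms(1)]
  by (rule iffI)

lemma isomorphic_card: "M \<cong>\<^sub>S N \<Longrightarrow> card (verts M) = card (verts N)"
  by (auto simp: isomorphic_def dest!: iso_map_bij intro: bij_betw_same_card)

text \<open>A uniformly chosen hypergraph on \<open>{..<n}\<close> is the random one with edge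
  probability 1/2, so this quotient is the probability that its clique structure is a copy of
  \<open>M\<close>.\<close>

definition clique_prob :: "('p \<Rightarrow> nat) \<Rightarrow> nat \<Rightarrow> ('p, 'v) struct \<Rightarrow> real" where
  "clique_prob ar m M =
     real (card {G \<in> Pow (nsets {..<card (verts M)} m).
                   clique_struct ar m {..<card (verts M)} G \<cong>\<^sub>S M})
       / 2 ^ (card (verts M) choose m)"

lemma clique_prob_cong:
  assumes "M \<cong>\<^sub>S N" and "wf_struct M"
  shows "clique_prob ar m M = clique_prob ar m N"
  using isomorphic_card[OF assms(1)]
  by (simp add: clique_prob_def isomorphic_cong_right[OF assms])

text \<open>Relabelling along a bijection from \<open>{..<n}\<close> to \<open>U\<close> matches the
  hypergraphs one to one and keeps isomorphism types. Hence the indicators of all vertex sets of the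
  right size have the same mean.\<close>

lemma clique_prob_exchangeable:
  fixes U :: "'u set" and M :: "('p, 'v) struct"
  assumes fin: "finite U" and card: "card U = card (verts M)"
  shows "real (card {G \<in> Pow (nsets U m). clique_struct ar m U G \<cong>\<^sub>S M})
           = clique_prob ar m M * 2 ^ (card (verts M) choose m)"
proof -
  let ?n = "card (verts M)"
  obtain f where f: "bij_betw f {..<?n} U"
    using ex_bij_betw_nat_finite[OF fin] card by (auto simp: lessThan_atLeast0)
  have b: "bij_betw (image (image f)) (Pow (nsets {..<?n} m)) (Pow (nsets U m))"
    by (intro bij_betw_Pow bij_betw_nsets f)
  have "clique_struct ar m U (image f ` G) \<cong>\<^sub>S M \<longleftrightarrow> clique_struct ar m {..<?n} G \<cong>\<^sub>S M"
    if "G \<in> Pow (nsets {..<?n} m)" for G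
  proof -
    have inj: "inj_on (image f) (nsets {..<?n} m)"
      using bij_betw_nsets[OF f] by (auto simp: bij_betw_def)
    have "iso_map f (clique_struct ar m {..<?n} G) (clique_struct ar m U (image f ` G))"
      using that by (intro iso_map_clique_struct[OF f] inj_on_image_mem_iff[OF inj]) auto
    then have iso: "clique_struct ar m {..<?n} G \<cong>\<^sub>S clique_struct ar m U (image f ` G)"
      unfolding isomorphic_def by blast
    show ?thesis by (simp add: isomorphic_cong_left[OF iso wf_clique_struct])
  qed
  then have "bij_betw (image (image f))
      {G \<in> Pow (nsets {..<?n} m). clique_struct ar m {..<?n} G \<cong>\<^sub>S M}
      {G \<in> Pow (nsets U m). clique_struct ar m U G \<cong>\<^sub>S M}"
    by (intro bij_betw_Collect[OF b])
  from bij_betw_same_card[OF this] show ?thesis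
    by (simp add: clique_prob_def)
qed

lemma clique_prob_bounds: "0 \<le> clique_prob ar m M" "clique_prob ar m M \<le> 1"
proof -
  show "0 \<le> clique_prob ar m M" by (simp add: clique_prob_def)
  let ?n = "card (verts M)"
  have "card {G \<in> Pow (nsets {..<?n} m). clique_struct ar m {..<?n} G \<cong>\<^sub>S M}
      \<le> card (Pow (nsets {..<?n} m))"
    by (intro card_mono) (auto simp: finite_imp_finite_nsets)
  also have "\<dots> = 2 ^ (?n choose m)"
    by (simp add: card_Pow finite_imp_finite_nsets)
  finally have "real (card {G \<in> Pow (nsets {..<?n} m). clique_struct ar m {..<?n} G \<cong>\<^sub>S M})
      \<le> real (2 ^ (?n choose m))"
    by (rule of_nat_mono)
  then show "clique_prob ar m M \<le> 1" by (simp add: clique_prob_def)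
qed

section \<open>Concentration of subgraph densities\<close>

text \<open>A subset of a disjoint union is a pair of independent choices: this is the finite form
  of independence on disjoint edge sets.\<close>

lemma sum_Pow_Un_disjoint:
  fixes f g :: "'a set \<Rightarrow> 'b::comm_semiring_0"
  assumes "A \<inter> B = {}"
  shows "(\<Sum>G\<in>Pow (A \<union> B). f (G \<inter> A) * g (G \<inter> B)) = (\<Sum>G\<in>Pow A. f G) * (\<Sum>G\<in>Pow B. g G)"
proof -
  have "(\<Sum>G\<in>Pow (A \<union> B). f (G \<inter> A) * g (G \<inter> B)) = (\<Sum>(G, H)\<in>Pow A \<times> Pow B. f G * g H)"
  proof (rule sum.reindex_bij_witness[of _ "\<lambda>(G, H). G \<union> H" "\<lambda>G. (G \<inter> A, G \<inter> B)"])
    fix GH assume "GH \<in> Pow A \<times> Pow B"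
    then have "fst GH \<subseteq> A" "snd GH \<subseteq> B" by auto
    then have "(fst GH \<union> snd GH) \<inter> A = fst GH" "(fst GH \<union> snd GH) \<inter> B = snd GH"
      using assms by blast+
    then show "((case GH of (G, H) \<Rightarrow> G \<union> H) \<inter> A, (case GH of (G, H) \<Rightarrow> G \<union> H) \<inter> B) = GH"
      by (simp add: case_prod_beta)
  qed auto
  then show ?thesis by (simp add: sum_product sum.cartesian_product)
qed

text \<open>Removing \<open>x\<close> leaves an arbitrary set with one element fewer; the absorption
  identity for binomials gives the product form, free of division.\<close>

lemma card_nsets_containing:
  assumes fin: "finite A" and x: "x \<in> A"
  shows "card {U \<in> nsets A n. x \<in> U} * card A = n * (card A choose n)"
proof (cases n)
  case 0
  then have "{U \<in> nsets A n. x \<in> U} = {}" by auto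
  with 0 show ?thesis by simp
next
  case (Suc k)
  obtain N where N: "card A = Suc N" using fin x by (metis card_Suc_Diff1)
  have "{U \<in> nsets A n. x \<in> U} = insert x ` nsets (A - {x}) k"
  proof (intro equalityI subsetI)
    fix U assume U: "U \<in> {U \<in> nsets A n. x \<in> U}"
    then have "U - {x} \<in> nsets (A - {x}) k" "U = insert x (U - {x})"
      using Suc by (auto simp: nsets_def card_Diff_singleton)
    then show "U \<in> insert x ` nsets (A - {x}) k" by blast
  qed (use Suc x in \<open>auto simp: nsets_def card_insert_if\<close>)
  moreover have "inj_on (insert x) (nsets (A - {x}) k)"
    by (rule inj_onI) (auto simp: nsets_def)
  ultimately have "card {U \<in> nsets A n. x \<in> U} = N choose k"
    using fin x N by (simp add: card_image)
  then show ?thesis using Suc_times_binomial[of k N] by (simp add: Suc N mult.commute)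
qed

text \<open>Count by common points instead of by pairs: two independent uniform
  \<open>n\<close>-sets share \<open>n^2 / card A\<close> points on average. This dominates the
  proportion of intersecting pairs and vanishes as \<open>A\<close> grows.\<close>

lemma sum_card_Int_nsets:
  assumes "finite A" and "A \<noteq> {}"
  shows "(\<Sum>U\<in>nsets A n. \<Sum>U'\<in>nsets A n. real (card (U \<inter> U')))
           = (real (card A choose n))\<^sup>2 * (real n)\<^sup>2 / real (card A)"
proof -
  have [simp]: "finite (nsets A n)" using assms(1) by (rule finite_imp_finite_nsets)
  have cA: "card A > 0" using assms by (simp add: card_gt_0_iff)
  have deg: "(\<Sum>U'\<in>nsets A n. of_bool (x \<in> U')) = real n * real (card A choose n) / real (card A)"
    if "x \<in> A" for x
  proof -
    have "(\<Sum>U'\<in>nsets A n. of_bool (x \<in> U')) = real (card {U \<in> nsets A n. x \<in> U})"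
      by (simp add: sum.If_cases of_bool_def Int_def)
    moreover have "real (card {U \<in> nsets A n. x \<in> U}) * real (card A)
        = real n * real (card A choose n)"
      using card_nsets_containing[OF assms(1) that, of n] by (metis of_nat_mult)
    ultimately show ?thesis using cA by (simp add: field_simps)
  qed
  have "(\<Sum>U'\<in>nsets A n. real (card (U \<inter> U')))
      = real n * (real n * real (card A choose n) / real (card A))"
    if U: "U \<in> nsets A n" for U
  proof -
    have "finite U" "U \<subseteq> A" "card U = n" using U by (auto simp: nsets_def)
    have "(\<Sum>U'\<in>nsets A n. real (card (U \<inter> U')))
        = (\<Sum>U'\<in>nsets A n. \<Sum>x\<in>U. of_bool (x \<in> U'))"
      using \<open>finite U\<close> by (simp add: sum.If_cases of_bool_def Int_def)
    also have "\<dots> = (\<Sum>x\<in>U. \<Sum>U'\<in>nsets A n. of_bool (x \<in> U'))" by (rule sum.swap)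
    also have "\<dots> = (\<Sum>x\<in>U. real n * real (card A choose n) / real (card A))"
      using \<open>U \<subseteq> A\<close> deg by (intro sum.cong) auto
    finally show ?thesis using \<open>card U = n\<close> by simp
  qed
  then show ?thesis using assms(1) by (simp add: power2_eq_square)
qed

lemma dens_cong:
  assumes "M \<cong>\<^sub>S N" and "wf_struct M"
  shows "dens M K = dens N K"
  using isomorphic_card[OF assms(1)]
  by (simp add: dens_def isomorphic_cong_right[OF assms])

lemma dens_clique_struct:
  assumes "finite V"
  shows "dens M (clique_struct ar m V G) =
    (\<Sum>U\<in>nsets V (card (verts M)). of_bool (clique_struct ar m U G \<cong>\<^sub>S M))
      / real (card V choose card (verts M))"
proof -
  let ?n = "card (verts M)"
  have "{U. U \<subseteq> V \<and> card U = ?n \<and> induced (clique_struct ar m V G) U \<cong>\<^sub>S M}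
      = {U \<in> nsets V ?n. clique_struct ar m U G \<cong>\<^sub>S M}"
    using assms by (auto simp: nsets_def induced_clique_struct intro: finite_subset)
  then show ?thesis
    using finite_imp_finite_nsets[OF assms]
    by (simp add: dens_def sum.If_cases of_bool_def Int_def)
qed

text \<open>Indicators of disjoint vertex sets depend on disjoint sets of edges, so only
  the pairs of intersecting vertex sets contribute to the variance.\<close>

lemma second_moment_dens:
  fixes M :: "('p, 'v) struct" and V :: "'u set"
  assumes m: "m > 0" and V: "finite V" "V \<noteq> {}" and n: "card (verts M) \<le> card V"
  shows "(\<Sum>G\<in>Pow (nsets V m). (dens M (clique_struct ar m V G) - clique_prob ar m M)\<^sup>2)
           \<le> 2 ^ (card V choose m) * ((real (card (verts M)))\<^sup>2 / real (card V))"
proof -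
  define n where "n = card (verts M)"
  define p where "p = clique_prob ar m M"
  define E where "E = nsets V m"
  define f where "f U G = of_bool (clique_struct ar m U G \<cong>\<^sub>S M) - p" for U :: "'u set" and G
  define c where "c = real (card V choose n)"
  have c: "c > 0" using n by (simp add: c_def n_def)
  have E: "finite E" using V by (simp add: E_def finite_imp_finite_nsets)
  have cE: "card (Pow E) = 2 ^ (card V choose m)" using V E by (simp add: card_Pow E_def)
  have f_le: "\<bar>f U G\<bar> \<le> 1" for U G
    using clique_prob_bounds[of ar m M] by (auto simp: f_def p_def)
  have f_local: "f U G = f U G'" if "G \<inter> nsets U m = G' \<inter> nsets U m" for U G G'
    using clique_struct_cong[OF that, of ar] by (simp add: f_def)
  \<comment> \<open>By exchangeability \<open>p\<close> is the mean of the indicator for every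
    \<open>U\<close>, so the centred \<open>f U\<close> sums to zero.\<close>
  have f_sum: "(\<Sum>G\<in>Pow (nsets U m). f U G) = 0" if "U \<in> nsets V n" for U
  proof -
    have U: "finite U" "card U = card (verts M)" using that by (auto simp: nsets_def n_def)
    have fin: "finite (Pow (nsets U m))" using U by (simp add: finite_imp_finite_nsets)
    have "(\<Sum>G\<in>Pow (nsets U m). f U G)
        = real (card {G \<in> Pow (nsets U m). clique_struct ar m U G \<cong>\<^sub>S M})
          - p * real (card (Pow (nsets U m)))"
      using fin by (simp add: f_def sum_subtractf of_bool_def sum.If_cases Int_def)
    also have "\<dots> = 0"
      using clique_prob_exchangeable[OF U, of m ar] U fin
      by (simp add: p_def card_Pow finite_imp_finite_nsets)
    finally show ?thesis .
  qed
  \<comment> \<open>The factor \<open>card (U \<inter> U')\<close> is 0 for disjoint sets and at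
    least 1 otherwise, so it covers both cases and can be summed exactly afterwards.\<close>
  have cov: "(\<Sum>G\<in>Pow E. f U G * f U' G) \<le> 2 ^ (card V choose m) * real (card (U \<inter> U'))"
    if U: "U \<in> nsets V n" and U': "U' \<in> nsets V n" for U U'
  proof (cases "U \<inter> U' = {}")
    case True
    let ?A = "nsets U m"
    have A: "?A \<subseteq> E" and A': "nsets U' m \<subseteq> E"
      using U U' unfolding E_def by (auto simp: nsets_def)
    have disj: "?A \<inter> nsets U' m = {}"
    proof -
      have "B \<noteq> {} \<and> B \<subseteq> U \<inter> U'" if "B \<in> ?A" "B \<in> nsets U' m" for B
        using that m by (auto simp: nsets_def)
      then show ?thesis using True by blast
    qed
    \<comment> \<open>Split the edges into those inside \<open>U\<close> and the rest, which contain
      those inside \<open>U'\<close>. The sum factors, and the factor of \<open>U\<close> is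
      zero.\<close>
    have "(\<Sum>G\<in>Pow E. f U G * f U' G)
        = (\<Sum>G\<in>Pow (?A \<union> (E - ?A)). f U (G \<inter> ?A) * f U' (G \<inter> (E - ?A)))"
    proof (rule sum.cong)
      show "Pow E = Pow (?A \<union> (E - ?A))" using A by auto
      fix G assume "G \<in> Pow (?A \<union> (E - ?A))"
      have "f U G = f U (G \<inter> ?A)" by (rule f_local) blast
      moreover have "f U' G = f U' (G \<inter> (E - ?A))" by (rule f_local) (use A' disj in blast)
      ultimately show "f U G * f U' G = f U (G \<inter> ?A) * f U' (G \<inter> (E - ?A))" by simp
    qed
    also have "\<dots> = (\<Sum>G\<in>Pow ?A. f U G) * (\<Sum>G\<in>Pow (E - ?A). f U' G)"
      by (rule sum_Pow_Un_disjoint) blast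
    finally show ?thesis using f_sum[OF U] by simp
  next
    case False
    have "finite (U \<inter> U')" using U by (auto simp: nsets_def)
    then have "1 \<le> card (U \<inter> U')" using False by (simp add: Suc_leI card_gt_0_iff)
    then have 1: "1 \<le> real (card (U \<inter> U'))" by simp
    have "f U G * f U' G \<le> 1" for G
    proof -
      have "\<bar>f U G * f U' G\<bar> \<le> 1 * 1"
        unfolding abs_mult by (intro mult_mono f_le) auto
      then show ?thesis by linarith
    qed
    then have "(\<Sum>G\<in>Pow E. f U G * f U' G) \<le> (\<Sum>G\<in>Pow E. 1)" by (rule sum_mono)
    also have "\<dots> = 2 ^ (card V choose m)"
      by (simp only: sum_constant cE of_nat_power of_nat_numeral mult_1_right)
    also have "\<dots> \<le> 2 ^ (card V choose m) * real (card (U \<inter> U'))"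
      using 1 by simp
    finally show ?thesis .
  qed
  have dens: "dens M (clique_struct ar m V G) - p = (\<Sum>U\<in>nsets V n. f U G) / c" for G
    using V c by (simp add: dens_clique_struct f_def n_def[symmetric] c_def[symmetric]
        sum_subtractf diff_divide_distrib)
  have "(\<Sum>G\<in>Pow E. (dens M (clique_struct ar m V G) - p)\<^sup>2)
      = (\<Sum>G\<in>Pow E. \<Sum>U\<in>nsets V n. \<Sum>U'\<in>nsets V n. f U G * f U' G) / c\<^sup>2"
    unfolding dens power_divide by (simp add: sum_divide_distrib power2_eq_square sum_product)
  also have "(\<Sum>G\<in>Pow E. \<Sum>U\<in>nsets V n. \<Sum>U'\<in>nsets V n. f U G * f U' G)
      = (\<Sum>U\<in>nsets V n. \<Sum>U'\<in>nsets V n. \<Sum>G\<in>Pow E. f U G * f U' G)"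
    by (subst sum.swap) (intro sum.cong refl sum.swap)
  also have "\<dots> \<le> (\<Sum>U\<in>nsets V n. \<Sum>U'\<in>nsets V n. 2 ^ (card V choose m) * real (card (U \<inter> U')))"
    by (intro sum_mono cov)
  also have "\<dots> = 2 ^ (card V choose m) * (c\<^sup>2 * (real n)\<^sup>2 / real (card V))"
    unfolding sum_distrib_left[symmetric] sum_card_Int_nsets[OF V] c_def ..
  also have "\<dots> / c\<^sup>2 = 2 ^ (card V choose m) * ((real n)\<^sup>2 / real (card V))"
    using c by (simp add: field_simps)
  finally show ?thesis by (simp add: E_def p_def n_def divide_right_mono)
qed

text \<open>At each stage one hypergraph is good for all small targets simultaneously, because their
  variances add up to little. A single sequence then serves every \<open>M\<close>.\<close>

lemma dens_tendsto_clique_prob: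
  fixes ar :: "'p \<Rightarrow> nat"
  assumes m: "m > 0"
  obtains a :: "nat \<Rightarrow> nat" and G :: "nat \<Rightarrow> nat set set" where
    "strict_mono a"
    "\<And>M :: ('p, nat) struct.
       (\<lambda>t. dens M (clique_struct ar m {..<a t} (G t))) \<longlonglongrightarrow> clique_prob ar m M"
proof -
  \<comment> \<open>The targets of stage \<open>t\<close>: finitely many clique structures, with
    each fixed one present from some stage on.\<close>
  define I where "I t = (SIGMA n:{..t}. Pow (nsets {..<n::nat} m))" for t
  define c where "c t = (\<Sum>(n, H)\<in>I t. n\<^sup>2)" for t
  \<comment> \<open>\<open>c t\<close> collects the numerators of the variance bounds. This size
    makes \<open>Suc (c t) / a t\<close> equal to \<open>1 / Suc t\<close>, is at least
    \<open>t\<close>, and grows strictly since \<open>c\<close> is monotone; the inner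
    \<open>Suc\<close> keeps it positive at \<open>t = 0\<close>, where \<open>c\<close>
    vanishes.\<close>
  define a where "a t = Suc t * Suc (c t)" for t :: nat
  define err where "err n H t G =
      (dens (clique_struct ar m {..<n} H) (clique_struct ar m {..<a t} G)
        - clique_prob ar m (clique_struct ar m {..<n} H))\<^sup>2" for n :: nat and H G and t
  have fin_I: "finite (I t)" for t
    by (auto simp: I_def finite_imp_finite_nsets)
  have "c t \<le> c (Suc t)" for t
    unfolding c_def by (intro sum_mono2 fin_I) (auto simp: I_def)
  then have "a t < a (Suc t)" for t
    unfolding a_def by (intro mult_less_le_imp_less) auto
  then have a: "strict_mono a" by (rule strict_monoI_Suc)
  \<comment> \<open>Averaging: were the total error larger for every hypergraph, its sum over all
    hypergraphs on \<open>{..<a t}\<close> would exceed the second moment bounds.\<close>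
  have "\<exists>G. (\<Sum>(n, H)\<in>I t. err n H t G) \<le> 1 / real (Suc t)" for t
  proof (rule ccontr)
    let ?E = "nsets {..<a t} m"
    assume "\<not> ?thesis"
    then have less: "1 / real (Suc t) < (\<Sum>(n, H)\<in>I t. err n H t G)" for G
      by (simp add: not_le)
    have fin: "finite (Pow ?E)" by (simp add: finite_imp_finite_nsets)
    have at: "0 < a t" "t \<le> a t" by (simp_all add: a_def)
    have ratio: "real (Suc (c t)) / real (a t) = 1 / real (Suc t)"
      unfolding a_def of_nat_mult by (simp del: of_nat_Suc)
    have "2 ^ (a t choose m) * (1 / real (Suc t)) = (\<Sum>G\<in>Pow ?E. 1 / real (Suc t))"
      by (simp add: card_Pow finite_imp_finite_nsets)
    also have "\<dots> < (\<Sum>G\<in>Pow ?E. \<Sum>(n, H)\<in>I t. err n H t G)"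
      by (rule sum_strict_mono[OF fin]) (use less in auto)
    also have "\<dots> = (\<Sum>(n, H)\<in>I t. \<Sum>G\<in>Pow ?E. err n H t G)"
      by (subst sum.swap) (simp add: case_prod_beta)
    also have "\<dots> \<le> (\<Sum>(n, H)\<in>I t. 2 ^ (a t choose m) * ((real n)\<^sup>2 / real (a t)))"
    proof (rule sum_mono, clarify)
      fix n H assume "(n, H) \<in> I t"
      then have "n \<le> a t" using at by (auto simp: I_def)
      then show "(\<Sum>G\<in>Pow ?E. err n H t G) \<le> 2 ^ (a t choose m) * ((real n)\<^sup>2 / real (a t))"
        unfolding err_def using at
          second_moment_dens[OF m, of "{..<a t}" "clique_struct ar m {..<n} H" ar]
        by (simp add: lessThan_empty_iff)
    qed
    also have "\<dots> = 2 ^ (a t choose m) * (real (c t) / real (a t))"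
      by (simp add: c_def case_prod_beta sum_distrib_left sum_divide_distrib)
    also have "\<dots> \<le> 2 ^ (a t choose m) * (real (Suc (c t)) / real (a t))"
      by (intro mult_left_mono divide_right_mono) auto
    also have "\<dots> = 2 ^ (a t choose m) * (1 / real (Suc t))"
      by (simp only: ratio)
    finally show False by simp
  qed
  then obtain G where G: "\<And>t. (\<Sum>(n, H)\<in>I t. err n H t (G t)) \<le> 1 / real (Suc t)" by metis
  have "(\<lambda>t. dens M (clique_struct ar m {..<a t} (G t))) \<longlonglongrightarrow> clique_prob ar m M"
    for M :: "('p, nat) struct"
  \<comment> \<open>Only copies of clique structures are controlled through \<open>I\<close>; for
    any other \<open>M\<close> both the densities and the limit are zero.\<close>
  proof (cases "\<exists>H\<in>Pow (nsets {..<card (verts M)} m). clique_struct ar m {..<card (verts M)} H \<cong>\<^sub>S M")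
    case True
    let ?n = "card (verts M)"
    let ?d = "\<lambda>t. dens M (clique_struct ar m {..<a t} (G t)) - clique_prob ar m M"
    obtain H where H: "H \<in> Pow (nsets {..<?n} m)" and M: "clique_struct ar m {..<?n} H \<cong>\<^sub>S M"
      using True by blast
    have err: "err ?n H t (G t) = (?d t)\<^sup>2" for t
      unfolding err_def dens_cong[OF M wf_clique_struct] clique_prob_cong[OF M wf_clique_struct] ..
    have "(?d t)\<^sup>2 \<le> 1 / real (Suc t)" if "t \<ge> ?n" for t
    proof -
      have "err ?n H t (G t) \<le> (\<Sum>(n, H)\<in>I t. err n H t (G t))"
        using member_le_sum[of "(?n, H)" "I t" "\<lambda>(n, H). err n H t (G t)"] fin_I H that
        by (auto simp: I_def err_def)
      then show ?thesis using G[of t] by (simp add: err)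
    qed
    then have "(\<lambda>t. (?d t)\<^sup>2) \<longlonglongrightarrow> 0"
      by (intro tendsto_sandwich[OF _ _ tendsto_const LIMSEQ_inverse_real_of_nat])
        (auto simp: eventually_sequentially inverse_eq_divide simp del: of_nat_Suc)
    then have "(\<lambda>t. sqrt ((?d t)\<^sup>2)) \<longlonglongrightarrow> sqrt 0" by (rule tendsto_real_sqrt)
    then have "?d \<longlonglongrightarrow> 0" by (simp add: tendsto_rabs_zero_iff)
    then show ?thesis by (simp add: LIM_zero_iff)
  next
    case False
    let ?n = "card (verts M)"
    have "{G \<in> Pow (nsets {..<?n} m). clique_struct ar m {..<?n} G \<cong>\<^sub>S M} = {}"
      using False by blast
    then have zero: "clique_prob ar m M = 0" by (simp only: clique_prob_def card.empty of_nat_0 div_0)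
    \<comment> \<open>A copy of \<open>M\<close> on \<open>U\<close>, with the edges outside
      \<open>U\<close> dropped, would be counted by exchangeability and make
      \<open>clique_prob\<close> nonzero.\<close>
    have none: "\<not> clique_struct ar m U K \<cong>\<^sub>S M" if U: "finite U" "card U = ?n" for U :: "nat set" and K
    proof
      assume "clique_struct ar m U K \<cong>\<^sub>S M"
      then have "K \<inter> nsets U m \<in> {G \<in> Pow (nsets U m). clique_struct ar m U G \<cong>\<^sub>S M}"
        using clique_struct_cong[of K U m "K \<inter> nsets U m" ar] by simp
      then have "card {G \<in> Pow (nsets U m). clique_struct ar m U G \<cong>\<^sub>S M} \<noteq> 0"
        using U by (auto simp: finite_imp_finite_nsets)
      then have "clique_prob ar m M \<noteq> 0"
        using clique_prob_exchangeable[OF U, of m ar] by auto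
      with zero show False by contradiction
    qed
    have "dens M (clique_struct ar m {..<a t} (G t)) = 0" for t
      using none by (simp add: dens_clique_struct nsets_def)
    then show ?thesis using zero by simp
  qed
  with a show ?thesis by (rule that)
qed

section \<open>Limit objects and couplings\<close>

text \<open>The chosen representative is immaterial since \<open>clique_prob\<close> is isomorphism
  invariant; the restriction to \<open>iso_types T\<close> gives the extensionality demanded by
  \<open>Hom_plus\<close>.\<close>

definition clique_limit ::
    "'p univ_theory \<Rightarrow> nat \<Rightarrow> ('p, nat) struct set \<Rightarrow> real" where
  "clique_limit T m = (\<lambda>C\<in>iso_types T. clique_prob (arity T) m (SOME M. M \<in> C))"

lemma clique_limit_iso_class:
  assumes "finite_model T M"
  shows "clique_limit T m (iso_class M) = clique_prob (arity T) m M"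
proof -
  have wf: "wf_struct M" using assms model_wf_struct by (auto simp: finite_model_def)
  have "M \<in> iso_class M" by (simp add: iso_class_def isomorphic_refl)
  then have "(SOME N. N \<in> iso_class M) \<in> iso_class M" by (rule someI)
  then have "M \<cong>\<^sub>S (SOME N. N \<in> iso_class M)" by (simp add: iso_class_def)
  then have "clique_prob (arity T) m (SOME N. N \<in> iso_class M) = clique_prob (arity T) m M"
    using clique_prob_cong[OF _ wf] by metis
  moreover have "iso_class M \<in> iso_types T" using assms by (auto simp: iso_types_def)
  ultimately show ?thesis by (simp add: clique_limit_def)
qed

lemma clique_limit_in_Hom_plus:
  fixes T :: "'p::finite univ_theory"
  assumes m: "m > 0"
    and model: "\<And>V G. model T (clique_struct (arity T) m (V :: nat set) G)"
  shows "clique_limit T m \<in> Hom_plus T"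
proof -
  obtain a :: "nat \<Rightarrow> nat" and G :: "nat \<Rightarrow> nat set set" where a: "strict_mono a" and
    lim: "\<And>M :: ('p, nat) struct. (\<lambda>t. dens M (clique_struct (arity T) m {..<a t} (G t)))
            \<longlonglongrightarrow> clique_prob (arity T) m M"
    using dens_tendsto_clique_prob[OF m, of "arity T"] by blast
  let ?N = "\<lambda>t. clique_struct (arity T) m {..<a t} (G t)"
  show ?thesis
    unfolding Hom_plus_def
  proof (intro CollectI conjI exI[of _ ?N])
    show "clique_limit T m \<in> iso_types T \<rightarrow>\<^sub>E {0..1}"
      using clique_prob_bounds by (auto simp: clique_limit_def)
    show "\<forall>t. finite_model T (?N t)" using model by (simp add: finite_model_def)
    show "strict_mono (\<lambda>t. card (verts (?N t)))" using a by simp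
    show "\<forall>M. finite_model T M \<longrightarrow> (\<lambda>t. dens M (?N t)) \<longlonglongrightarrow> clique_limit T m (iso_class M)"
      using lim by (simp add: clique_limit_iso_class)
  qed
qed

text \<open>A sum over an infinite index set is 0 by convention, so the projection sums need this.
  Each class has a representative on \<open>{..<n}\<close>, where a finite language admits finitely
  many structures.\<close>

lemma finite_iso_types_card:
  fixes T :: "'p::finite univ_theory"
  shows "finite (iso_class ` {M. finite_model T M \<and> card (verts M) = n})"
proof (rule finite_subset)
  let ?R = "\<Pi>\<^sub>E P\<in>UNIV. Pow {xs :: nat list. set xs \<subseteq> {..<n} \<and> length xs = arity T P}"
  let ?S = "\<lambda>R. \<lparr>verts = {..<n}, rel = R\<rparr> :: ('p, nat) struct"
  show "finite (iso_class ` ?S ` ?R)"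
    by (intro finite_imageI finite_PiE) (simp_all add: finite_lists_length_eq)
  show "iso_class ` {M. finite_model T M \<and> card (verts M) = n} \<subseteq> iso_class ` ?S ` ?R"
  proof
    fix D assume "D \<in> iso_class ` {M. finite_model T M \<and> card (verts M) = n}"
    then obtain M where M: "finite_model T M" "card (verts M) = n" and D: "D = iso_class M"
      by blast
    have rel: "length xs = arity T P \<and> set xs \<subseteq> verts M" if "xs \<in> rel M P" for xs P
      using M that by (auto simp: finite_model_def model_def)
    obtain f where f: "bij_betw f (verts M) {..<n}"
      using ex_bij_betw_finite_nat[of "verts M"] M by (auto simp: finite_model_def lessThan_atLeast0)
    let ?K = "?S (\<lambda>P. map f ` rel M P)"
    have "iso_map f M ?K" using f by (intro iso_mapI) auto
    moreover have "wf_struct M" using M model_wf_struct by (auto simp: finite_model_def)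
    ultimately have "D = iso_class ?K"
      using iso_class_cong D unfolding isomorphic_def by blast
    moreover have "(\<lambda>P. map f ` rel M P) \<in> ?R"
      using rel bij_betwE[OF f] by (fastforce simp: PiE_def)
    ultimately show "D \<in> iso_class ` ?S ` ?R" by blast
  qed
qed

text \<open>Both sides count the same hypergraphs \<open>G\<close>: those whose
  \<open>T\<close>-structure is a copy of \<open>M\<close>, on the right sorted by the class of
  their \<open>S\<close>-structure. The abstract \<open>r\<close> covers both reducts.\<close>

lemma clique_limit_reduct:
  fixes r :: "('s::finite, nat) struct \<Rightarrow> ('p::finite, nat) struct"
  assumes verts: "\<And>M. verts (r M) = verts M"
    and iso: "\<And>M N f. iso_map f M N \<Longrightarrow> iso_map f (r M) (r N)"
    and clique: "\<And>V G. r (clique_struct (arity S) m V G) = clique_struct (arity T) m V G"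
    and model: "\<And>V G. model S (clique_struct (arity S) m (V :: nat set) G)"
    and C: "C \<in> iso_types T"
  shows "clique_limit T m C
           = (\<Sum>D | D \<in> iso_types S \<and> (\<exists>N\<in>D. r N \<in> C). clique_limit S m D)"
proof -
  obtain M where M: "finite_model T M" and CM: "C = iso_class M"
    using C by (auto simp: iso_types_def)
  have wfM: "wf_struct M" using M model_wf_struct by (auto simp: finite_model_def)
  define n where "n = card (verts M)"
  define J where "J = {D \<in> iso_types S. \<exists>N\<in>D. r N \<in> C}"
  define E where "E = nsets {..<n} m"
  let ?h = "\<lambda>G. iso_class (clique_struct (arity S) m {..<n} G)"
  have finE: "finite (Pow E)" by (simp add: E_def finite_imp_finite_nsets)
  \<comment> \<open>Reducts keep the vertex set, so only classes on \<open>n\<close> vertices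
    contribute.\<close>
  have J: "\<exists>L. D = iso_class L \<and> finite_model S L \<and> card (verts L) = n" if D: "D \<in> J" for D
  proof -
    obtain L where L: "D = iso_class L" "finite_model S L"
      using D by (auto simp: J_def iso_types_def)
    obtain N where N: "N \<in> D" "r N \<in> C" using D by (auto simp: J_def)
    have "card (verts L) = card (verts N)"
      using N L by (intro isomorphic_card) (simp add: iso_class_def)
    moreover have "card (verts M) = card (verts (r N))"
      using N by (intro isomorphic_card) (simp add: iso_class_def CM)
    ultimately show ?thesis using L by (auto simp: n_def verts)
  qed
  have finJ: "finite J"
    by (rule finite_subset[OF _ finite_iso_types_card[of S n]]) (use J in blast)
  have D: "clique_limit S m D = real (card {G \<in> Pow E. ?h G = D}) / 2 ^ (n choose m)"
    if DJ: "D \<in> J" for D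
  proof -
    obtain L where L: "D = iso_class L" "finite_model S L" "card (verts L) = n"
      using J[OF DJ] by blast
    have "clique_struct (arity S) m {..<n} G \<cong>\<^sub>S L \<longleftrightarrow> ?h G = D" for G
    proof
      show "?h G = D" if "clique_struct (arity S) m {..<n} G \<cong>\<^sub>S L"
        unfolding L(1) by (rule iso_class_cong[OF that wf_clique_struct])
      assume "?h G = D"
      then have "L \<in> ?h G" by (simp add: L(1) iso_class_def isomorphic_refl)
      then show "clique_struct (arity S) m {..<n} G \<cong>\<^sub>S L" by (simp add: iso_class_def)
    qed
    then show ?thesis
      using L by (simp add: clique_limit_iso_class clique_prob_def E_def)
  qed
  have h: "?h G \<in> J \<longleftrightarrow> clique_struct (arity T) m {..<n} G \<cong>\<^sub>S M" for G
  proof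
    let ?K = "clique_struct (arity S) m {..<n} G"
    assume "?h G \<in> J"
    then obtain N where "?K \<cong>\<^sub>S N" and N: "M \<cong>\<^sub>S r N"
      by (auto simp: J_def CM iso_class_def)
    then have "r ?K \<cong>\<^sub>S r N" using iso unfolding isomorphic_def by blast
    then show "clique_struct (arity T) m {..<n} G \<cong>\<^sub>S M"
      unfolding clique by (rule isomorphic_trans[OF _ isomorphic_sym[OF N wfM]])
  next
    let ?K = "clique_struct (arity S) m {..<n} G"
    assume "clique_struct (arity T) m {..<n} G \<cong>\<^sub>S M"
    then have "M \<cong>\<^sub>S clique_struct (arity T) m {..<n} G"
      by (rule isomorphic_sym[OF _ wf_clique_struct])
    then have "r ?K \<in> C" by (simp add: clique CM iso_class_def)
    moreover have "?K \<in> ?h G" by (simp add: iso_class_def isomorphic_refl)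
    moreover have "?h G \<in> iso_types S"
      unfolding iso_types_def using model by (intro imageI) (simp add: finite_model_def)
    ultimately show "?h G \<in> J" unfolding J_def by blast
  qed
  have "{G \<in> Pow E. clique_struct (arity T) m {..<n} G \<cong>\<^sub>S M}
      = (\<Union>D\<in>J. {G \<in> Pow E. ?h G = D})"
    using h by blast
  also have "card \<dots> = (\<Sum>D\<in>J. card {G \<in> Pow E. ?h G = D})"
    using finJ finE by (intro card_UN_disjoint) auto
  finally have "real (card {G \<in> Pow E. clique_struct (arity T) m {..<n} G \<cong>\<^sub>S M})
      = (\<Sum>D\<in>J. real (card {G \<in> Pow E. ?h G = D}))"
    by (simp only: of_nat_sum)
  then have "clique_limit T m C = (\<Sum>D\<in>J. clique_limit S m D)"
    unfolding CM clique_limit_iso_class[OF M]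
    by (simp add: clique_prob_def n_def[symmetric] E_def[symmetric] D sum_divide_distrib)
  then show ?thesis by (simp only: J_def)
qed

text \<open>Forgetting predicates leaves \<open>G\<close> untouched, so the two marginals are read
  off from one common random hypergraph.\<close>

lemma coupling_clique_limit:
  fixes T :: "'p::finite univ_theory" and T' :: "'q::finite univ_theory"
  assumes m: "m > 0"
    and T: "\<And>V G. model T (clique_struct (arity T) m (V :: nat set) G)"
    and T': "\<And>V G. model T' (clique_struct (arity T') m (V :: nat set) G)"
  shows "coupling T T' (clique_limit T m) (clique_limit T' m) (clique_limit (T \<uplus>\<^sub>T T') m)"
proof -
  have red: "reductl (clique_struct (arity (T \<uplus>\<^sub>T T')) m V G) = clique_struct (arity T) m V G"
      "reductr (clique_struct (arity (T \<uplus>\<^sub>T T')) m V G) = clique_struct (arity T') m V G"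
    for V :: "nat set" and G
    by (simp_all add: reductl_clique_struct reductr_clique_struct disj_union_def comp_def)
  have model: "model (T \<uplus>\<^sub>T T') (clique_struct (arity (T \<uplus>\<^sub>T T')) m V G)" for V :: "nat set" and G
    by (rule model_disj_union) (simp_all only: red T T')
  show ?thesis
    unfolding coupling_def
  proof (intro conjI ballI)
    show "clique_limit (T \<uplus>\<^sub>T T') m \<in> Hom_plus (T \<uplus>\<^sub>T T')"
      by (rule clique_limit_in_Hom_plus[OF m model])
    show "clique_limit T m C
        = (\<Sum>D | D \<in> iso_types (T \<uplus>\<^sub>T T') \<and> (\<exists>N\<in>D. reductl N \<in> C). clique_limit (T \<uplus>\<^sub>T T') m D)"
      if "C \<in> iso_types T" for C
      by (rule clique_limit_reduct[OF _ iso_map_reductl red(1) model that])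
        (simp add: reductl_def)
    show "clique_limit T' m C
        = (\<Sum>D | D \<in> iso_types (T \<uplus>\<^sub>T T') \<and> (\<exists>N\<in>D. reductr N \<in> C). clique_limit (T \<uplus>\<^sub>T T') m D)"
      if "C \<in> iso_types T'" for C
      by (rule clique_limit_reduct[OF _ iso_map_reductr red(2) model that])
        (simp add: reductr_def)
  qed
qed

section \<open>The complete structure and the failure of UInduce\<close>

lemma card_Aut_clique_struct:
  assumes "finite V"
  shows "card (Aut (clique_struct ar m V (nsets V m))) = fact (card V)"
proof -
  have "iso_map f (clique_struct ar m V (nsets V m)) (clique_struct ar m V (nsets V m))"
    if "f permutes V" for f
  proof (rule iso_map_clique_struct)
    show b: "bij_betw f V V" using that by (rule permutes_imp_bij)
    show "f ` B \<in> nsets V m \<longleftrightarrow> B \<in> nsets V m" if "B \<in> nsets V m" for B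
      using bij_betwE[OF bij_betw_nsets[OF b]] that by blast
  qed
  then have "Aut (clique_struct ar m V (nsets V m)) = {f. f permutes V}"
    by (auto simp: Aut_def)
  then show ?thesis using assms by (simp add: card_permutations)
qed

text \<open>A single predicate of arity between \<open>m\<close> and \<open>card V\<close> detects a
  missing edge: every \<open>m\<close>-set lies in the entries of some tuple of that predicate. So
  only the complete hypergraph is counted.\<close>

lemma clique_prob_complete:
  fixes V :: "'v set"
  assumes V: "finite V" and P: "m \<le> ar P" "ar P \<le> card V"
  shows "clique_prob ar m (clique_struct ar m V (nsets V m)) = 1 / 2 ^ (card V choose m)"
proof -
  let ?M = "clique_struct ar m V (nsets V m)"
  have "G = nsets V m" if G: "G \<in> Pow (nsets V m)" and iso: "clique_struct ar m V G \<cong>\<^sub>S ?M" for G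
  proof (intro equalityI subsetI)
    fix B assume B: "B \<in> nsets V m"
    obtain f where f: "iso_map f (clique_struct ar m V G) ?M"
      using iso by (auto simp: isomorphic_def)
    have sub: "rel (clique_struct ar m V G) P \<subseteq> rel ?M P"
      using nsets_mono by (auto simp: rel_clique_struct)
    have fin: "finite (rel ?M P)"
      by (rule finite_subset[OF _ finite_lists_length_eq[OF V, of "ar P"]])
        (auto simp: rel_clique_struct)
    \<comment> \<open>The isomorphism need not be the identity, but it equates cardinalities;
      inclusion of finite sets then forces equality.\<close>
    have "card (rel ?M P) \<le> card (rel (clique_struct ar m V G) P)"
      unfolding iso_map_rel[OF f] by (rule card_image_le) (rule finite_subset[OF sub fin])
    then have rel: "rel (clique_struct ar m V G) P = rel ?M P"
      by (rule card_seteq[OF fin sub])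
    obtain A where A: "B \<subseteq> A" "A \<subseteq> V" "card A = ar P"
      using exists_subset_between[of B "ar P" V] B P V by (auto simp: nsets_def)
    obtain xs where xs: "set xs = A" "distinct xs"
      using finite_distinct_list[of A] A V finite_subset by blast
    then have "length xs = ar P" using A by (metis distinct_card)
    then have "xs \<in> rel ?M P" using xs A nsets_mono[OF A(2)] by (simp add: rel_clique_struct)
    then have "nsets A m \<subseteq> G" unfolding rel[symmetric] using xs by (simp add: rel_clique_struct)
    then show "B \<in> G" using A B by (auto simp: nsets_def)
  qed (use G in blast)
  then have "{G \<in> Pow (nsets V m). clique_struct ar m V G \<cong>\<^sub>S ?M} = {nsets V m}"
    using isomorphic_refl by blast
  then show ?thesis
    using clique_prob_exchangeable[OF V, of ?M m ar] by (simp add: field_simps)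
qed

text \<open>The violating \<psi> is the limit of \<open>G\<close> itself, coupled through the common
  \<open>G\<close> and tested on the complete structure with \<open>k\<close> vertices.\<close>

lemma not_UInduce_clique_limit:
  assumes m: "0 < m" and mk: "m \<le> k"
  shows "\<not> UInduce m (hypergraph_theory k) (clique_limit (hypergraph_theory k) m)"
proof
  let ?T = "hypergraph_theory k" and ?T' = "hypergraph_theory m"
  define S where "S = ?T \<uplus>\<^sub>T ?T'"
  define V where "V = {..<k}"
  define M where "M = clique_struct (arity S) m V (nsets V m)"
  define x :: real where "x = 1 / 2 ^ (k choose m)"
  assume U: "UInduce m ?T (clique_limit ?T m)"
  have ar: "arity (hypergraph_theory j) = (\<lambda>_. j)" for j by (simp add: hypergraph_theory_def)
  have model: "model (hypergraph_theory j) (clique_struct (arity (hypergraph_theory j)) m W G)"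
    for j and W :: "nat set" and G
    unfolding ar by (rule model_clique_hypergraph)
  have coupling: "coupling ?T ?T' (clique_limit ?T m) (clique_limit ?T' m) (clique_limit S m)"
    unfolding S_def by (rule coupling_clique_limit[OF m model model])
  have V: "finite V" "card V = k" by (simp_all add: V_def)
  have red: "reductl M = clique_struct (arity ?T) m V (nsets V m)"
      "reductr M = clique_struct (arity ?T') m V (nsets V m)"
    by (simp_all add: M_def S_def reductl_clique_struct reductr_clique_struct disj_union_def comp_def)
  have finite_model: "finite_model S M"
    unfolding finite_model_def S_def
    by (intro conjI model_disj_union) (simp_all only: red model, simp add: M_def V)
  have "complete_hypergraph m (reductr M)"
    unfolding red complete_hypergraph_def rel_clique_struct ar using nsets_mono by auto
  then have "clique_limit S m (iso_class M)
      = indep_coupling ?T ?T' (clique_limit ?T m) (clique_limit ?T' m) (iso_class M)"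
    using U coupling finite_model clique_limit_in_Hom_plus[OF m model]
    unfolding UInduce_def S_def by blast
  then have "labelled (clique_limit S m) M
      = labelled (clique_limit ?T m) (reductl M) * labelled (clique_limit ?T' m) (reductr M)"
    using labelled_indep_coupling[OF finite_model[unfolded S_def], of "clique_limit ?T m" "clique_limit ?T' m"]
    by (simp add: labelled_def)
  \<comment> \<open>All permutations are automorphisms, so the normalising factor is 1 and the value
    is the probability that \<open>G\<close> is complete on \<open>V\<close>.\<close>
  moreover have labelled: "labelled (clique_limit R m) (clique_struct (arity R) m V (nsets V m)) = x"
    if "m \<le> arity R P" "arity R P \<le> k"
      "finite_model R (clique_struct (arity R) m V (nsets V m))" for R :: "'r univ_theory" and P
    using that clique_prob_complete[OF V(1), of m "arity R" P] V
    by (simp add: labelled_def clique_limit_iso_class card_Aut_clique_struct x_def)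
  have "labelled (clique_limit S m) M = x"
    unfolding M_def
    by (rule labelled[of S "Inl ()"]) (use finite_model mk in \<open>simp_all add: M_def S_def disj_union_def ar\<close>)
  moreover have "labelled (clique_limit ?T m) (reductl M) = x"
      "labelled (clique_limit ?T' m) (reductr M) = x"
    unfolding red using mk model V by (intro labelled[of _ "()"]; simp add: ar finite_model_def)+
  ultimately have "x = x * x" by simp
  \<comment> \<open>From \<open>m \<le> k\<close> the exponent \<open>k choose m\<close> is
    positive, which excludes the solution \<open>x = 1\<close>.\<close>
  moreover have "0 < x" "x < 1"
    using mk by (simp_all add: x_def zero_less_binomial_iff)
  ultimately show False by simp
qed

section \<open>The theon of cliques\<close>

text \<open>Lebesgue rather than Borel sets, because \<open>Independence\<close> asks for a complete
  measure.\<close>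

abbreviation unit_interval :: "real measure" where
  "unit_interval \<equiv> lebesgue_on {0..1}"

lemma prob_space_unit_interval: "prob_space unit_interval"
  by (rule prob_spaceI) (simp add: emeasure_restrict_space)

lemma complete_unit_interval: "complete_measure unit_interval"
proof
  fix A B :: "real set"
  assume "B \<subseteq> A" "A \<in> null_sets unit_interval"
  then have "A \<subseteq> {0..1}" "A \<in> null_sets lebesgue"
    using null_sets_restrict_space[of "{0..1}" lebesgue A] by auto
  then show "B \<in> sets unit_interval"
    using \<open>B \<subseteq> A\<close> completion.complete[of B A] by (auto simp: sets_restrict_space_iff)
qed

lemma sets_unit_interval: "A \<subseteq> {0..1} \<Longrightarrow> A \<in> sets borel \<Longrightarrow> A \<in> sets unit_interval"
  by (simp add: sets_restrict_space_iff)

lemma measure_unit_interval_halves: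
  "measure unit_interval {0..1/2} = 1/2" "measure unit_interval {1/2<..1} = 1/2"
proof -
  have "{0..1/2} \<subseteq> {0..1::real}" "{1/2<..1} \<subseteq> {0..1::real}" by auto
  then show "measure unit_interval {0..1/2} = 1/2" "measure unit_interval {1/2<..1} = 1/2"
    by (simp_all add: measure_restrict_space)
qed

text \<open>Cut \<open>A\<close> by intervals of length \<open>1 / Suc n\<close>, shorter than its
  measure. Some piece has positive measure, yet less than \<open>A\<close>; overlaps are harmless
  for subadditivity.\<close>

lemma atomless_unit_interval: "atomless unit_interval"
  unfolding atomless_def
proof (intro ballI impI)
  fix A assume A: "A \<in> sets unit_interval" and pos: "0 < emeasure unit_interval A"
  interpret prob_space unit_interval by (rule prob_space_unit_interval)
  have "0 < prob A" using pos by (simp add: emeasure_eq_measure)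
  then obtain n where n: "inverse (real (Suc n)) < prob A" using reals_Archimedean by blast
  define J where "J i = {real i / real (Suc n)..real (Suc i) / real (Suc n)}" for i
  have sets: "A \<inter> J i \<in> sets unit_interval" for i
    using A by (auto simp: sets_restrict_space_iff J_def)
  have "A \<subseteq> (\<Union>i\<in>{..Suc n}. A \<inter> J i)"
  proof
    fix x assume "x \<in> A"
    then have x: "0 \<le> x" "x \<le> 1" using sets.sets_into_space[OF A] by auto
    \<comment> \<open>The point \<open>x = 1\<close> receives the index \<open>Suc n\<close>, hence
      the range \<open>{..Suc n}\<close>.\<close>
    define i where "i = nat \<lfloor>x * real (Suc n)\<rfloor>"
    have i: "real i \<le> x * real (Suc n)" "x * real (Suc n) \<le> real (Suc i)"
      using x by (simp_all add: i_def, linarith+)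
    have "real i \<le> 1 * real (Suc n)"
      by (rule order_trans[OF i(1) mult_right_mono]) (use x in auto)
    then have "i \<le> Suc n" by simp
    moreover have "x \<in> J i"
      using i by (simp add: J_def pos_divide_le_eq pos_le_divide_eq del: of_nat_Suc)
    ultimately show "x \<in> (\<Union>i\<in>{..Suc n}. A \<inter> J i)" using \<open>x \<in> A\<close> by blast
  qed
  then have "prob A \<le> prob (\<Union>i\<in>{..Suc n}. A \<inter> J i)"
    using sets by (intro finite_measure_mono sets.finite_UN) auto
  also have "\<dots> \<le> (\<Sum>i\<in>{..Suc n}. prob (A \<inter> J i))"
    using sets by (intro finite_measure_subadditive_finite) auto
  finally have "0 < (\<Sum>i\<in>{..Suc n}. prob (A \<inter> J i))" using \<open>0 < prob A\<close> by (rule less_le_trans[rotated])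
  moreover have "(\<Sum>i\<in>{..Suc n}. prob (A \<inter> J i)) \<le> 0" if "\<And>i. \<not> 0 < prob (A \<inter> J i)"
    by (intro sum_nonpos) (simp only: that linorder_not_less[symmetric] simp_thms)
  ultimately obtain i where i: "0 < prob (A \<inter> J i)" by (meson not_less)
  have "prob (A \<inter> J i) = measure lebesgue (A \<inter> J i)"
    using sets.sets_into_space[OF A] by (intro measure_restrict_space) auto
  also have "\<dots> \<le> measure lebesgue (J i)"
    using A by (intro measure_mono_fmeasurable) (auto simp: J_def sets_restrict_space_iff)
  also have "\<dots> = inverse (real (Suc n))"
    by (simp add: J_def divide_right_mono inverse_eq_divide diff_divide_distrib[symmetric])
  finally have "prob (A \<inter> J i) < prob A" using n by linarith
  with i show "\<exists>B\<in>sets unit_interval. B \<subseteq> A \<and> 0 < emeasure unit_interval B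
      \<and> emeasure unit_interval B < emeasure unit_interval A"
    using sets by (intro bexI[of _ "A \<inter> J i"]) (auto simp: emeasure_eq_measure ennreal_less_iff)
qed

text \<open>The coordinate at an \<open>m\<close>-set decides whether it is an edge; the threshold
  1/2 produces the edge probability.\<close>

definition clique_peon :: "nat \<Rightarrow> nat \<Rightarrow> (nat set \<Rightarrow> real) set" where
  "clique_peon k m =
     {x \<in> fin_subsets {..<k} \<rightarrow>\<^sub>E {0..1}. \<forall>A\<in>nsets {..<k} m. x A \<le> 1/2}"

lemma nsets_subset_fin_subsets: "m > 0 \<Longrightarrow> nsets V m \<subseteq> fin_subsets V"
  by (auto simp: nsets_def fin_subsets_def)

lemma clique_peon_in_sets:
  assumes m: "m > 0"
  shows "clique_peon k m \<in> sets (\<E> {..<k} unit_interval)"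
proof -
  let ?X = "\<lambda>A. if A \<in> nsets {..<k} m then {0..1/2} else {0..1} :: real set"
  have "finite (fin_subsets {..<k})"
    by (rule finite_subset[of _ "Pow {..<k}"]) (auto simp: fin_subsets_def)
  moreover have "?X A \<in> sets unit_interval" for A
    by (intro sets_unit_interval) auto
  ultimately have "Pi\<^sub>E (fin_subsets {..<k}) ?X \<in> sets (Pi\<^sub>M (fin_subsets {..<k}) (\<lambda>_. unit_interval))"
    by (intro sets_PiM_I_finite) auto
  moreover have "clique_peon k m = Pi\<^sub>E (fin_subsets {..<k}) ?X"
  proof -
    have "x A \<in> ?X A \<longleftrightarrow> x A \<in> {0..1} \<and> (A \<in> nsets {..<k} m \<longrightarrow> x A \<le> 1/2)"
      for x :: "nat set \<Rightarrow> real" and A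
      by auto
    then have "Pi\<^sub>E (fin_subsets {..<k}) ?X = {x \<in> fin_subsets {..<k} \<rightarrow>\<^sub>E {0..1}.
        \<forall>A\<in>fin_subsets {..<k}. A \<in> nsets {..<k} m \<longrightarrow> x A \<le> 1/2}"
      unfolding PiE_iff set_eq_iff mem_Collect_eq by blast
    also have "\<dots> = clique_peon k m"
      unfolding clique_peon_def using nsets_subset_fin_subsets[OF m, of "{..<k}"] by blast
    finally show ?thesis by (rule sym)
  qed
  ultimately show ?thesis by (simp only: \<E>_def sets_completionI_sets)
qed

text \<open>All constraints sit at sets of size \<open>m > l\<close>, hence in \<open>J\<close>,
  while the coordinates in \<open>I\<close> stay free.\<close>

lemma indep_peon_clique_peon:
  assumes l: "l < m"
  shows "indep_peon l k unit_interval (clique_peon k m)"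
proof -
  define I where "I = {A \<in> fin_subsets {..<k}. card A \<le> l}"
  define J where "J = {A \<in> fin_subsets {..<k}. card A > l}"
  have IJ: "I \<union> J = fin_subsets {..<k}" "I \<inter> J = {}" by (auto simp: I_def J_def)
  have sub: "nsets {..<k} m \<subseteq> J"
    using l by (auto simp: nsets_def J_def fin_subsets_def)
  define H where "H = {x \<in> J \<rightarrow>\<^sub>E {0..1::real}. \<forall>A\<in>nsets {..<k} m. x A \<le> 1/2}"
  have "clique_peon k m = merge I J ` ((I \<rightarrow>\<^sub>E {0..1}) \<times> H)"
  proof (intro equalityI subsetI)
    fix x assume x: "x \<in> clique_peon k m"
    then have "x = merge I J (restrict x I, restrict x J)"
      using IJ by (auto simp: clique_peon_def PiE_def extensional_restrict)
    moreover have "restrict x I \<in> I \<rightarrow>\<^sub>E {0..1}"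
      using x IJ by (auto simp: clique_peon_def)
    moreover have "restrict x J \<in> H"
      using x IJ sub by (auto simp: clique_peon_def H_def)
    ultimately show "x \<in> merge I J ` ((I \<rightarrow>\<^sub>E {0..1}) \<times> H)" by blast
  next
    fix x assume "x \<in> merge I J ` ((I \<rightarrow>\<^sub>E {0..1}) \<times> H)"
    then obtain y z where x: "x = merge I J (y, z)" and y: "y \<in> I \<rightarrow>\<^sub>E {0..1}" and z: "z \<in> H"
      by blast
    have "x A \<le> 1/2" if "A \<in> nsets {..<k} m" for A
      using that sub z IJ(2) by (auto simp: x H_def)
    moreover have "x \<in> I \<union> J \<rightarrow>\<^sub>E {0..1}"
      using y z IJ(2) by (auto simp: x H_def PiE_def Pi_def)
    ultimately show "x \<in> clique_peon k m" by (simp add: clique_peon_def IJ)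
  qed
  moreover have "H \<subseteq> J \<rightarrow>\<^sub>E {0..1}" by (auto simp: H_def)
  ultimately show ?thesis
    unfolding indep_peon_def Let_def I_def[symmetric] J_def[symmetric] by auto
qed

text \<open>A repetition-free \<alpha> matches the \<open>m\<close>-subsets of \<open>{..<k}\<close>
  with those of its range, so the pulled-back test is the clique test. It holds at every point of
  the space, so no null set has to be discarded.\<close>

lemma theon_struct_clique_peon:
  assumes m: "m > 0" and \<theta>: "\<theta> \<in> fin_subsets UNIV \<rightarrow>\<^sub>E {0..1}"
  shows "theon_struct (hypergraph_theory k) (\<lambda>_. clique_peon k m) \<theta>
           = clique_struct (\<lambda>_. k) m UNIV {A. \<theta> A \<le> 1/2}"
proof -
  have "pullback \<alpha> \<theta> \<in> clique_peon k m \<longleftrightarrow> nsets (set \<alpha>) m \<subseteq> {A. \<theta> A \<le> 1/2}"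
    if \<alpha>: "length \<alpha> = k" "distinct \<alpha>" for \<alpha>
  proof -
    have "bij_betw ((!) \<alpha>) {..<k} (set \<alpha>)" using \<alpha> by (intro bij_betw_nth) auto
    then have nsets: "nsets (set \<alpha>) m = image ((!) \<alpha>) ` nsets {..<k} m"
      using bij_betw_nsets[of "(!) \<alpha>" "{..<k}" "set \<alpha>" m] by (simp add: bij_betw_def)
    have "pullback \<alpha> \<theta> \<in> fin_subsets {..<k} \<rightarrow>\<^sub>E {0..1}"
      using \<theta> \<alpha> by (auto simp: pullback_def fin_subsets_def)
    moreover have "pullback \<alpha> \<theta> A = \<theta> ((!) \<alpha> ` A)" if "A \<in> nsets {..<k} m" for A
      using that \<alpha> nsets_subset_fin_subsets[OF m] by (auto simp: pullback_def)
    ultimately show ?thesis by (auto simp: clique_peon_def nsets)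
  qed
  then show ?thesis
    by (auto simp: theon_struct_def clique_struct_def hypergraph_theory_def)
qed

lemma theon_clique_peon:
  assumes m: "m > 0"
  shows "theon (hypergraph_theory k) unit_interval (\<lambda>_. clique_peon k m)"
proof -
  have "model (hypergraph_theory k) (theon_struct (hypergraph_theory k) (\<lambda>_. clique_peon k m) \<theta>)"
    if "\<theta> \<in> space (\<E> UNIV unit_interval)" for \<theta>
  proof -
    have "\<theta> \<in> fin_subsets UNIV \<rightarrow>\<^sub>E {0..1}" using that by (simp add: \<E>_def space_PiM)
    then show ?thesis by (simp add: theon_struct_clique_peon[OF m] model_clique_hypergraph)
  qed
  then show ?thesis
    using clique_peon_in_sets[OF m] by (auto simp: theon_def hypergraph_theory_def)
qed

text \<open>The event is a disjoint union of cylinders, one for each hypergraph on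
  \<open>{..<n}\<close> that yields a copy of \<open>M\<close>, and all cylinders have equal
  measure.\<close>

lemma theon_dens_clique_peon:
  assumes m: "m > 0"
  shows "theon_dens (hypergraph_theory k) unit_interval (\<lambda>_. clique_peon k m) M
           = clique_prob (\<lambda>_. k) m M"
proof -
  let ?F = "fin_subsets (UNIV :: nat set)"
  let ?P = "Pi\<^sub>M ?F (\<lambda>_. unit_interval)"
  define n where "n = card (verts M)"
  define E where "E = nsets {..<n} m"
  define B where "B = {G \<in> Pow E. clique_struct (\<lambda>_. k) m {..<n} G \<cong>\<^sub>S M}"
  \<comment> \<open>The two halves of the interval, for edge and non-edge, both have measure 1/2, so
    the measure of a cylinder does not depend on \<open>G\<close>.\<close>
  define X where "X G A = (if A \<in> G then {0..1/2} else {1/2<..1::real})" for G :: "nat set set" and A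
  define C where "C G = prod_emb ?F (\<lambda>_. unit_interval) E (Pi\<^sub>E E (X G))" for G
  interpret product_prob_space "\<lambda>_. unit_interval" ?F
    by (rule product_prob_spaceI) (rule prob_space_unit_interval)
  have E: "E \<subseteq> ?F" "finite E"
    using nsets_subset_fin_subsets[OF m, of "{..<n}"]
    by (auto simp: E_def fin_subsets_def finite_imp_finite_nsets)
  have X: "X G A \<in> sets unit_interval" for G A
    by (auto simp: X_def intro!: sets_unit_interval)
  have C_sets: "C G \<in> sets ?P" for G
    unfolding C_def using E X by (intro sets_PiM_I) auto
  have "measure ?P (C G) = (\<Prod>A\<in>E. measure unit_interval (X G A))" for G
    unfolding C_def using E X by (intro measure_PiM_emb) auto
  moreover have "measure unit_interval (X G A) = 1/2" for G A
    by (simp add: X_def measure_unit_interval_halves)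
  ultimately have C_measure: "measure ?P (C G) = 1 / 2 ^ (n choose m)" for G
    by (simp add: E_def power_one_over)
  have C_iff: "\<theta> \<in> C G \<longleftrightarrow> \<theta> \<in> space ?P \<and> {A. \<theta> A \<le> 1/2} \<inter> E = G" if "G \<subseteq> E" for \<theta> G
  proof -
    have "\<theta> A \<in> X G A \<longleftrightarrow> (\<theta> A \<le> 1/2 \<longleftrightarrow> A \<in> G)" if "\<theta> \<in> space ?P" "A \<in> E" for A
      using that E PiE_mem[of \<theta> ?F "\<lambda>_. {0..1}" A] by (auto simp: X_def space_PiM)
    then show ?thesis
      using \<open>G \<subseteq> E\<close> by (auto simp: C_def prod_emb_def space_PiM PiE_def Pi_def)
  qed
  have "{\<theta> \<in> space (\<E> UNIV unit_interval).
      induced (theon_struct (hypergraph_theory k) (\<lambda>_. clique_peon k m) \<theta>) {..<n} \<cong>\<^sub>S M}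
      = (\<Union>G\<in>B. C G)"
  proof (intro equalityI subsetI)
    have induced: "induced (theon_struct (hypergraph_theory k) (\<lambda>_. clique_peon k m) \<theta>) {..<n}
        = clique_struct (\<lambda>_. k) m {..<n} ({A. \<theta> A \<le> 1/2} \<inter> E)"
      if "\<theta> \<in> space ?P" for \<theta>
      using that clique_struct_cong[of "{A. \<theta> A \<le> 1/2}" "{..<n}" m "{A. \<theta> A \<le> 1/2} \<inter> E" "\<lambda>_. k"]
      by (simp add: theon_struct_clique_peon[OF m] induced_clique_struct space_PiM E_def Int_assoc)
    {
      fix \<theta> assume \<theta>: "\<theta> \<in> {\<theta> \<in> space (\<E> UNIV unit_interval).
        induced (theon_struct (hypergraph_theory k) (\<lambda>_. clique_peon k m) \<theta>) {..<n} \<cong>\<^sub>S M}"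
      then have "\<theta> \<in> space ?P" by (simp add: \<E>_def)
      then have "{A. \<theta> A \<le> 1/2} \<inter> E \<in> B" "\<theta> \<in> C ({A. \<theta> A \<le> 1/2} \<inter> E)"
        using \<theta> induced C_iff by (simp_all add: B_def)
      then show "\<theta> \<in> (\<Union>G\<in>B. C G)" by blast
    next
      fix \<theta> assume "\<theta> \<in> (\<Union>G\<in>B. C G)"
      then obtain G where "G \<in> B" "\<theta> \<in> C G" by blast
      then have "\<theta> \<in> space ?P" "{A. \<theta> A \<le> 1/2} \<inter> E \<in> B" using C_iff[of G \<theta>] by (auto simp: B_def)
      then show "\<theta> \<in> {\<theta> \<in> space (\<E> UNIV unit_interval).
        induced (theon_struct (hypergraph_theory k) (\<lambda>_. clique_peon k m) \<theta>) {..<n} \<cong>\<^sub>S M}"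
        using induced by (simp add: \<E>_def B_def)
    }
  qed
  then have "theon_dens (hypergraph_theory k) unit_interval (\<lambda>_. clique_peon k m) M
      = measure (completion ?P) (\<Union>G\<in>B. C G)"
    unfolding theon_dens_def n_def[symmetric] by (simp add: \<E>_def)
  \<comment> \<open>A finite union of cylinders is measurable before completion, where the product
    formula applies.\<close>
  also have "\<dots> = measure ?P (\<Union>G\<in>B. C G)"
    using C_sets E(2) by (intro measure_completion sets.finite_UN) (auto simp: B_def)
  also have "\<dots> = (\<Sum>G\<in>B. measure ?P (C G))"
  proof (rule P.finite_measure_finite_Union)
    show "finite B" using E(2) by (simp add: B_def)
    show "C ` B \<subseteq> sets ?P" using C_sets by blast
    show "disjoint_family_on C B"
      unfolding disjoint_family_on_def
    proof (intro ballI impI)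
      fix G H assume "G \<in> B" "H \<in> B" "G \<noteq> H"
      then show "C G \<inter> C H = {}" using C_iff[of G] C_iff[of H] by (auto simp: B_def)
    qed
  qed
  also have "\<dots> = clique_prob (\<lambda>_. k) m M"
    by (simp add: C_measure clique_prob_def B_def E_def n_def)
  finally show ?thesis .
qed

theorem theorem3p5:
  fixes l k :: nat
  assumes "l < k"
  shows "\<exists>\<phi> \<in> Hom_plus (hypergraph_theory k).
           Independence l (hypergraph_theory k) \<phi> \<and>
           \<not> UInduce (l + 1) (hypergraph_theory k) \<phi>"
proof (intro bexI conjI)
  let ?T = "hypergraph_theory k"
  have ar: "arity ?T = (\<lambda>_. k)" by (simp add: hypergraph_theory_def)
  \<comment> \<open>The size \<open>l + 1\<close> exceeds \<open>l\<close>, as independence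
    requires, and is at most \<open>k\<close>, so that \<open>k\<close>-cliques really constrain
    edges.\<close>
  show "\<not> UInduce (l + 1) ?T (clique_limit ?T (l + 1))"
    using assms by (intro not_UInduce_clique_limit) auto
  show "clique_limit ?T (l + 1) \<in> Hom_plus ?T"
    by (rule clique_limit_in_Hom_plus) (simp_all add: ar model_clique_hypergraph)
  show "Independence l ?T (clique_limit ?T (l + 1))"
    unfolding Independence_def
  proof (intro exI[of _ unit_interval] exI[of _ "\<lambda>_. clique_peon k (l + 1)"] conjI allI impI)
    show "indep_peon l (arity ?T P) unit_interval (clique_peon k (l + 1))" for P
      unfolding ar by (rule indep_peon_clique_peon) simp
    show "clique_limit ?T (l + 1) (iso_class M)
        = theon_dens ?T unit_interval (\<lambda>_. clique_peon k (l + 1)) M" if "finite_model ?T M" for M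
      by (simp add: clique_limit_iso_class[OF that] theon_dens_clique_peon ar)
  qed (simp_all add: prob_space_unit_interval complete_unit_interval atomless_unit_interval
      theon_clique_peon)
qed

end
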